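(* Not every biconnected outer-$1$-plane graph of maximum degree $4$ has an $\mathrm{SC}_1$-layout; that is, there exists a biconnected outer-$1$-plane graph of maximum degree $4$ that has no $\mathrm{SC}_1$-layout respecting its given embedding.
   Context: Graphs are finite and simple. A drawing maps vertices to distinct points of $\mathbb{R}^2$ and edges to curves joining the points of their endpoints; edges do not pass through other vertices, and edges with a common endpoint do not cross. A drawing is $1$-planar if each edge is crossed at most once, and outer-$1$-planar if in addition every vertex lies on the outer (unbounded) face. An outer-$1$-plane graph is a graph together with an outer-$1$-planar embedding, i.e. an outer-$1$-planar drawing in the plane considered up to its combinatorial structure: the cyclic order of the edges around each vertex, which edges cross and in which order, and the outer face. A layout of an outer-$1$-plane graph is always required to respect (realize) the given embedding. A smooth orthogonal layout is a drawing in which each edge is drawn as a sequence of segments, each of which is a vertical or horizontal line segment or a circular arc that is a quarter arc, a semicircle, or a three-quarter arc, such that consecutive segments of an edge have a common tangent at their common point (the edge is a smooth curve). Every vertex has four ports (North, South, East, West), each edge enters and leaves its end vertices at ports with a horizontal or vertical tangent, and no two edges incident to the same vertex use the same port. The curve complexity of a drawing is the maximum number of segments (line segments and arcs) used for an edge. An $\mathrm{SC}_k$-layout is a smooth orthogonal layout with curve complexity at most $k$. "Maximum degree $4$" means every vertex has degree at most $4$. *)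

theory Defs
  imports "HOL-Complex_Analysis.Contour_Integration"
begin

section \<open>Finite simple graphs\<close>

text \<open>A graph is given by its vertex set \<open>V\<close> and its set \<open>E\<close> of two-element edges.\<close>

definition simple_graph :: "'a set \<Rightarrow> 'a set set \<Rightarrow> bool" where
  "simple_graph V E \<longleftrightarrow> finite V \<and> (\<forall>e\<in>E. e \<subseteq> V \<and> card e = 2)"

definition vertex_degree :: "'a set set \<Rightarrow> 'a \<Rightarrow> nat" where
  "vertex_degree E v = card {e \<in> E. v \<in> e}"

definition graph_connected :: "'a set \<Rightarrow> 'a set set \<Rightarrow> bool" where
  "graph_connected V E \<longleftrightarrow> (\<forall>u\<in>V. \<forall>v\<in>V. (u, v) \<in> {(x, y). {x, y} \<in> E}\<^sup>*)"

definition biconnected :: "'a set \<Rightarrow> 'a set set \<Rightarrow> bool" where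
  "biconnected V E \<longleftrightarrow> 3 \<le> card V \<and> graph_connected V E \<and>
     (\<forall>x\<in>V. graph_connected (V - {x}) {e \<in> E. x \<notin> e})"


section \<open>Cyclic order of curves leaving a point\<close>

text \<open>The plane is \<^typ>\<open>complex\<close>.  \<open>first_hit g r\<close> is the first point of the curve \<open>g\<close> on the
  circle of radius \<open>r\<close> about its start point (meaningful when \<open>g\<close> reaches that circle).\<close>

definition first_hit :: "(real \<Rightarrow> complex) \<Rightarrow> real \<Rightarrow> complex" where
  "first_hit g r = g (Inf {t \<in> {0..1}. dist (pathstart g) (g t) = r})"

definition ccw_dirs :: "complex \<Rightarrow> complex \<Rightarrow> complex \<Rightarrow> bool" where
  "ccw_dirs a b c \<longleftrightarrow> 0 < Arg2pi (b / a) \<and> Arg2pi (b / a) < Arg2pi (c / a)"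

text \<open>Three curves with the same start point leave it in counterclockwise order.
  For arcs that are disjoint apart from their start point, the cyclic order of the first hits does
  not depend on \<open>r\<close> once \<open>r\<close> is small, even if the arcs have no tangent there.\<close>

definition ccw_curves ::
    "(real \<Rightarrow> complex) \<Rightarrow> (real \<Rightarrow> complex) \<Rightarrow> (real \<Rightarrow> complex) \<Rightarrow> bool" where
  "ccw_curves f g h \<longleftrightarrow> (\<forall>\<^sub>F r in at_right 0.
     ccw_dirs (first_hit f r - pathstart f) (first_hit g r - pathstart g)
              (first_hit h r - pathstart h))"

text \<open>Two curves cross (rather than touch) at a common interior point \<open>p\<close>: the four partial curves
  leaving \<open>p\<close> belong alternately to the two curves.\<close>

definition cross_at :: "(real \<Rightarrow> complex) \<Rightarrow> (real \<Rightarrow> complex) \<Rightarrow> complex \<Rightarrow> bool" where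
  "cross_at g h p \<longleftrightarrow> (\<exists>s\<in>{0<..<1}. \<exists>t\<in>{0<..<1}. g s = p \<and> h t = p \<and>
     (let g1 = subpath s 1 g; g2 = subpath s 0 g; h1 = subpath t 1 h; h2 = subpath t 0 h
      in ccw_curves g1 h1 g2 \<and> ccw_curves g2 h2 g1 \<or>
         ccw_curves g1 h2 g2 \<and> ccw_curves g2 h1 g1))"


section \<open>Drawings\<close>

text \<open>\<open>curve D u v\<close> is the curve of the edge \<open>{u, v}\<close>, traversed from \<open>u\<close> to \<open>v\<close>.\<close>

record 'a drawing =
  pos :: "'a \<Rightarrow> complex"
  curve :: "'a \<Rightarrow> 'a \<Rightarrow> real \<Rightarrow> complex"

definition is_drawing :: "'a set \<Rightarrow> 'a set set \<Rightarrow> 'a drawing \<Rightarrow> bool" where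
  "is_drawing V E D \<longleftrightarrow>
     inj_on (pos D) V \<and>
     (\<forall>u v. {u, v} \<in> E \<longrightarrow>
        arc (curve D u v) \<and> pathstart (curve D u v) = pos D u \<and>
        pathfinish (curve D u v) = pos D v \<and> curve D v u = reversepath (curve D u v)) \<and>
     (\<forall>u v. {u, v} \<in> E \<longrightarrow> (\<forall>w\<in>V - {u, v}. pos D w \<notin> path_image (curve D u v))) \<and>
     (\<forall>u v w. {u, v} \<in> E \<longrightarrow> {u, w} \<in> E \<longrightarrow> v \<noteq> w \<longrightarrow>
        path_image (curve D u v) \<inter> path_image (curve D u w) = {pos D u}) \<and>
     (\<forall>u v x y. {u, v} \<in> E \<longrightarrow> {x, y} \<in> E \<longrightarrow> {u, v} \<inter> {x, y} = {} \<longrightarrow>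
        (\<forall>p \<in> path_image (curve D u v) \<inter> path_image (curve D x y).
           cross_at (curve D u v) (curve D x y) p))"

definition edge_image :: "'a drawing \<Rightarrow> 'a set \<Rightarrow> complex set" where
  "edge_image D e = \<Union>{path_image (curve D u v) | u v. e = {u, v}}"

text \<open>In a drawing, the common points of two edges without a common endpoint are exactly the
  crossings, by the last clause of \<^const>\<open>is_drawing\<close>.\<close>

definition crossings :: "'a set set \<Rightarrow> 'a drawing \<Rightarrow> ('a set \<times> 'a set \<times> complex) set" where
  "crossings E D = {(e, f, p). e \<in> E \<and> f \<in> E \<and> e \<inter> f = {} \<and>
                               p \<in> edge_image D e \<inter> edge_image D f}"

definition crossing_points :: "'a set set \<Rightarrow> 'a drawing \<Rightarrow> complex set" where
  "crossing_points E D = {p. \<exists>e f. (e, f, p) \<in> crossings E D}"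

definition one_planar :: "'a set \<Rightarrow> 'a set set \<Rightarrow> 'a drawing \<Rightarrow> bool" where
  "one_planar V E D \<longleftrightarrow> is_drawing V E D \<and>
     (\<forall>e f f' p p'. (e, f, p) \<in> crossings E D \<longrightarrow> (e, f', p') \<in> crossings E D \<longrightarrow>
        f = f' \<and> p = p')"

definition outer_face :: "'a set \<Rightarrow> 'a set set \<Rightarrow> 'a drawing \<Rightarrow> complex set" where
  "outer_face V E D = outside (pos D ` V \<union> (\<Union>e\<in>E. edge_image D e))"

definition outer_one_planar :: "'a set \<Rightarrow> 'a set set \<Rightarrow> 'a drawing \<Rightarrow> bool" where
  "outer_one_planar V E D \<longleftrightarrow> one_planar V E D \<and>
     (\<forall>v\<in>V. pos D v \<in> frontier (outer_face V E D))"

definition outer_one_plane_graph :: "'a set \<Rightarrow> 'a set set \<Rightarrow> 'a drawing \<Rightarrow> bool" where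
  "outer_one_plane_graph V E D \<longleftrightarrow> simple_graph V E \<and> outer_one_planar V E D"


section \<open>Embeddings\<close>

text \<open>The outer face reaches \<open>v\<close> in the angle swept counterclockwise from the edge \<open>{v, u}\<close> to the
  edge \<open>{v, w}\<close>: some arc leaves \<open>v\<close> in that angle and then stays in the outer face.  These angles
  say which face is the outer one; the set of vertices or edges on its boundary would not
  (a cycle has two faces with the same boundary).\<close>

definition outer_angle :: "'a set \<Rightarrow> 'a set set \<Rightarrow> 'a drawing \<Rightarrow> 'a \<Rightarrow> 'a \<Rightarrow> 'a \<Rightarrow> bool" where
  "outer_angle V E D v u w \<longleftrightarrow> (\<exists>g. arc g \<and> pathstart g = pos D v \<and>
     g ` {0<..1} \<subseteq> outer_face V E D \<and> ccw_curves (curve D v u) g (curve D v w))"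

definition precedes_along :: "(real \<Rightarrow> complex) \<Rightarrow> complex \<Rightarrow> complex \<Rightarrow> bool" where
  "precedes_along g p q \<longleftrightarrow> (\<exists>s t. 0 \<le> s \<and> s < t \<and> t \<le> 1 \<and> g s = p \<and> g t = q)"

text \<open>Two drawings of one graph have the same embedding if they agree in the cyclic order of the
  edges around each vertex, in which edges cross and in which order along each edge (\<open>\<phi>\<close> matches
  the crossing points), and in the outer face.\<close>

definition same_embedding ::
    "'a set \<Rightarrow> 'a set set \<Rightarrow> 'a drawing \<Rightarrow> 'a drawing \<Rightarrow> bool" where
  "same_embedding V E D D' \<longleftrightarrow>
     (\<forall>v a b c. {v, a} \<in> E \<longrightarrow> {v, b} \<in> E \<longrightarrow> {v, c} \<in> E \<longrightarrow>
        (ccw_curves (curve D v a) (curve D v b) (curve D v c) \<longleftrightarrow>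
         ccw_curves (curve D' v a) (curve D' v b) (curve D' v c))) \<and>
     (\<exists>\<phi>. bij_betw \<phi> (crossing_points E D) (crossing_points E D') \<and>
        (\<forall>p\<in>crossing_points E D.
           {e \<in> E. p \<in> edge_image D e} = {e \<in> E. \<phi> p \<in> edge_image D' e}) \<and>
        (\<forall>u v. {u, v} \<in> E \<longrightarrow>
           (\<forall>p\<in>crossing_points E D \<inter> edge_image D {u, v}.
            \<forall>q\<in>crossing_points E D \<inter> edge_image D {u, v}.
              precedes_along (curve D u v) p q \<longleftrightarrow>
              precedes_along (curve D' u v) (\<phi> p) (\<phi> q)))) \<and>
     (\<forall>v u w. {v, u} \<in> E \<longrightarrow> {v, w} \<in> E \<longrightarrow>
        (outer_angle V E D v u w \<longleftrightarrow> outer_angle V E D' v u w))"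


section \<open>Smooth orthogonal layouts\<close>

text \<open>Circular arcs need not be assumed to start in an axis-parallel direction: this follows from
  the conditions on the ports and on consecutive segments.\<close>

definition smooth_segment :: "(real \<Rightarrow> complex) \<Rightarrow> bool" where
  "smooth_segment s \<longleftrightarrow>
     (\<exists>a b. a \<noteq> b \<and> (Re a = Re b \<or> Im a = Im b) \<and> s = linepath a b) \<or>
     (\<exists>c r \<alpha> \<beta>. 0 < r \<and> \<bar>\<beta> - \<alpha>\<bar> \<in> {pi / 2, pi, 3 * pi / 2} \<and> s = part_circlepath c r \<alpha> \<beta>)"

definition start_dir :: "(real \<Rightarrow> complex) \<Rightarrow> complex" where
  "start_dir s = sgn (vector_derivative s (at 0))"

definition end_dir :: "(real \<Rightarrow> complex) \<Rightarrow> complex" where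
  "end_dir s = sgn (vector_derivative s (at 1))"

text \<open>The curve \<open>g\<close> consists of the consecutive segments \<open>ss\<close>, up to parametrization.  As the
  segments meet without cusps and \<open>g\<close> will be an arc, equality of the images is enough.\<close>

definition smooth_chain :: "(real \<Rightarrow> complex) list \<Rightarrow> (real \<Rightarrow> complex) \<Rightarrow> bool" where
  "smooth_chain ss g \<longleftrightarrow> ss \<noteq> [] \<and> (\<forall>s\<in>set ss. smooth_segment s) \<and>
     (\<forall>i. Suc i < length ss \<longrightarrow>
        pathfinish (ss ! i) = pathstart (ss ! Suc i) \<and> end_dir (ss ! i) = start_dir (ss ! Suc i)) \<and>
     pathstart (hd ss) = pathstart g \<and> pathfinish (last ss) = pathfinish g \<and>
     (\<Union>s\<in>set ss. path_image s) = path_image g"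

text \<open>The East, North, West and South port, as the direction in which an edge leaves the vertex.\<close>

definition ports :: "complex set" where
  "ports = {1, \<i>, -1, -\<i>}"

text \<open>\<open>S u v\<close> lists the segments of the edge \<open>{u, v}\<close> from \<open>u\<close> to \<open>v\<close>; the port used at \<open>v\<close> is
  the one from which \<open>S v u\<close> starts.\<close>

definition SC_layout :: "nat \<Rightarrow> 'a set \<Rightarrow> 'a set set \<Rightarrow> 'a drawing \<Rightarrow> bool" where
  "SC_layout k V E D \<longleftrightarrow> is_drawing V E D \<and>
     (\<exists>S. (\<forall>u v. {u, v} \<in> E \<longrightarrow>
             smooth_chain (S u v) (curve D u v) \<and> length (S u v) \<le> k \<and>
             start_dir (hd (S u v)) \<in> ports) \<and>
          (\<forall>u v w. {u, v} \<in> E \<longrightarrow> {u, w} \<in> E \<longrightarrow> v \<noteq> w \<longrightarrow>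
             start_dir (hd (S u v)) \<noteq> start_dir (hd (S u w))))"

end

(* A single segment whose ports d and e at its ends p and q are known determines the line
   through p and q: it is axis-parallel if d and e are parallel and has slope 1 or -1 otherwise.
   Let a, b, c, d be a four-cycle with two crossing diagonals whose vertices all have degree 4, so
   that the embedding fixes the ports up to a rotation at each vertex.  The six lines leave only a
   collinear position, which the signs exclude, and the corners of a square standing on a vertex.
   A semicircle over a diagonal of the square would pass through a third vertex, so the diagonals
   are line segments, and the block is a circle with two perpendicular diameters and its
   remaining ports pointing outwards.  The counterexample joins two such blocks by two crossing
   edges.  Up to rotation there are four relative orientations of the two circles: in one of them
   the lengths have the wrong sign, in two of them two vertices coincide, and in the last one the
   links are semicircles that cannot meet. *)
theory Submission
  imports Defs
begin

section \<open>Directions in which curves leave their start points\<close>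

text \<open>Ports and rotations have to be compared although they come from different sources: a
  port is the derivative of a segment, a rotation is defined by first hits of a curve that shares
  only its image with the segment and may have no derivative at all. The common ground is the limit
  direction of the first hits on small circles. For a line segment or a circular arc it depends on
  the image alone, and distinct limit directions decide the cyclic order. The graph is built so that
  every port of a block is forced. The sides and diagonals of a block give each of its vertices only
  degree 3. Two of them get their fourth edge from the links, the other two from a common neighbour
  of degree 2, so that biconnectedness and the outer face survive. The reference drawing lies on a
  parabola with integer abscissas. The slope of a chord is then the sum of its two abscissas, and
  crossings and cyclic orders become signs of integer products.\<close>

lemma first_hit_mem:
  assumes "path g" "0 < r" "r < dist (pathstart g) (pathfinish g)"
  shows "first_hit g r \<in> path_image g" "dist (pathstart g) (first_hit g r) = r"
proof -
  let ?T = "{t \<in> {0..1}. dist (pathstart g) (g t) = r}"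
  have cont: "continuous_on {0..1} (\<lambda>t. dist (pathstart g) (g t))"
    using assms(1) unfolding path_def by (intro continuous_intros)
  have "\<exists>t\<ge>0. t \<le> 1 \<and> dist (pathstart g) (g t) = r"
    using assms(2,3) cont by (intro IVT') (auto simp: pathstart_def pathfinish_def)
  then have "?T \<noteq> {}" by auto
  moreover have "closed ?T"
    using continuous_closed_preimage_constant[OF cont] by simp
  moreover have "bdd_below ?T" by (auto simp: bdd_below_def)
  ultimately have "Inf ?T \<in> ?T" by (intro closed_contains_Inf)
  then show "first_hit g r \<in> path_image g" "dist (pathstart g) (first_hit g r) = r"
    unfolding first_hit_def path_image_def by auto
qed

definition leaves :: "(real \<Rightarrow> complex) \<Rightarrow> complex \<Rightarrow> bool" where
  "leaves g d \<longleftrightarrow> ((\<lambda>r. (first_hit g r - pathstart g) / of_real r) \<longlongrightarrow> d) (at_right 0)"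

lemma leaves_unique: "leaves g d \<Longrightarrow> leaves g e \<Longrightarrow> d = e"
  unfolding leaves_def by (rule tendsto_unique) (simp_all add: trivial_limit_at_right_real)

text \<open>Which point of a small circle is hit first depends on the parametrization. Requiring the
  limit along every choice of image points on these circles avoids the question.\<close>

lemma leavesI:
  assumes "path g" "pathstart g \<noteq> pathfinish g"
    and "\<And>z. \<forall>\<^sub>F r in at_right 0. z r \<in> path_image g \<and> dist (pathstart g) (z r) = r
           \<Longrightarrow> ((\<lambda>r. (z r - pathstart g) / of_real r) \<longlongrightarrow> d) (at_right 0)"
  shows "leaves g d"
  unfolding leaves_def
proof (rule assms(3))
  have "\<forall>\<^sub>F r in at_right 0. r \<in> {0<..<dist (pathstart g) (pathfinish g)}"
    using assms(2) by (intro eventually_at_right_real) simp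
  then show "\<forall>\<^sub>F r in at_right 0. first_hit g r \<in> path_image g \<and> dist (pathstart g) (first_hit g r) = r"
    by eventually_elim (use first_hit_mem[OF assms(1)] in auto)
qed

lemma ccw_dirs_scale: "c \<noteq> 0 \<Longrightarrow> ccw_dirs (u / c) (v / c) (w / c) \<longleftrightarrow> ccw_dirs u v w"
  by (simp add: ccw_dirs_def)

text \<open>\<open>Arg2pi\<close> is discontinuous only on the nonnegative real axis, and the
  quotient of two distinct numbers of norm 1 does not lie there.\<close>

lemma tendsto_Arg2pi_quotient:
  assumes "(f \<longlongrightarrow> u) F" "(g \<longlongrightarrow> v) F" "norm u = 1" "norm v = 1" "u \<noteq> v"
  shows "((\<lambda>x. Arg2pi (g x / f x)) \<longlongrightarrow> Arg2pi (v / u)) F"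
proof -
  have u0: "u \<noteq> 0" using assms(3) by auto
  have "v / u \<notin> \<real>\<^sub>\<ge>\<^sub>0"
  proof
    assume "v / u \<in> \<real>\<^sub>\<ge>\<^sub>0"
    then obtain t where t: "v / u = of_real t" "t \<ge> 0" by (auto simp: nonneg_Reals_def)
    have "norm (v / u) = 1" using assms(3,4) by (simp add: norm_divide)
    then have "t = 1" using t by simp
    then show False using t(1) assms(5) u0 by simp
  qed
  then have "isCont Arg2pi (v / u)" by (rule continuous_at_Arg2pi)
  moreover have "((\<lambda>x. g x / f x) \<longlongrightarrow> v / u) F"
    using assms(1,2) u0 by (intro tendsto_divide)
  ultimately show ?thesis by (rule isCont_tendsto_compose)
qed

text \<open>Strict inequalities between the limit angles persist for small radii. Conversely the
  limit yields only weak inequalities, which become strict because the three directions are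
  distinct.\<close>

lemma ccw_curves_iff:
  assumes "leaves f u" "leaves g v" "leaves h w"
    and "norm u = 1" "norm v = 1" "norm w = 1" "u \<noteq> v" "v \<noteq> w" "u \<noteq> w"
  shows "ccw_curves f g h \<longleftrightarrow> ccw_dirs u v w"
proof -
  define F where "F r = (first_hit f r - pathstart f) / of_real r" for r
  define G where "G r = (first_hit g r - pathstart g) / of_real r" for r
  define H where "H r = (first_hit h r - pathstart h) / of_real r" for r
  have ev0: "\<forall>\<^sub>F r in at_right 0. (0::real) < r" by (simp add: eventually_at_right_less)
  have ccw: "ccw_curves f g h \<longleftrightarrow> (\<forall>\<^sub>F r in at_right 0. ccw_dirs (F r) (G r) (H r))"
    unfolding ccw_curves_def
    by (rule eventually_cong[OF ev0]) (simp add: F_def G_def H_def ccw_dirs_scale)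
  have lims: "((\<lambda>r. Arg2pi (G r / F r)) \<longlongrightarrow> Arg2pi (v / u)) (at_right 0)"
    "((\<lambda>r. Arg2pi (H r / F r)) \<longlongrightarrow> Arg2pi (w / u)) (at_right 0)"
    unfolding F_def G_def H_def
    using tendsto_Arg2pi_quotient[OF assms(1,2)[unfolded leaves_def] assms(4,5,7)]
      tendsto_Arg2pi_quotient[OF assms(1,3)[unfolded leaves_def] assms(4,6,9)] .
  have u0: "u \<noteq> 0" using assms(4) by auto
  have ne: "Arg2pi (v / u) \<noteq> Arg2pi (w / u)"
  proof
    assume eq: "Arg2pi (v / u) = Arg2pi (w / u)"
    have "norm (v / u) = norm (w / u)" using assms by (simp add: norm_divide)
    with eq have "v / u = w / u" using Arg2pi_eq[of "v / u"] Arg2pi_eq[of "w / u"] by simp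
    then show False using assms(8) u0 by simp
  qed
  have pos: "0 < Arg2pi (v / u)"
  proof (rule ccontr)
    assume "\<not> 0 < Arg2pi (v / u)"
    then have "Arg2pi (v / u) = 0" using Arg2pi[of "v / u"] by linarith
    moreover have "norm (v / u) = 1" using assms by (simp add: norm_divide)
    ultimately have "v / u = 1" using Arg2pi_eq[of "v / u"] by simp
    then show False using assms(7) u0 by simp
  qed
  show ?thesis
  proof
    assume "ccw_dirs u v w"
    then have lt: "Arg2pi (v / u) < Arg2pi (w / u)" by (simp add: ccw_dirs_def)
    then obtain m where m: "Arg2pi (v / u) < m" "m < Arg2pi (w / u)" using dense by blast
    have "\<forall>\<^sub>F r in at_right 0. ccw_dirs (F r) (G r) (H r)"
      using order_tendstoD(1)[OF lims(1) pos] order_tendstoD(2)[OF lims(1) m(1)]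
        order_tendstoD(1)[OF lims(2) m(2)]
      by eventually_elim (simp add: ccw_dirs_def)
    then show "ccw_curves f g h" using ccw by simp
  next
    assume "ccw_curves f g h"
    then have ev: "\<forall>\<^sub>F r in at_right 0. ccw_dirs (F r) (G r) (H r)" using ccw by simp
    then have "\<forall>\<^sub>F r in at_right 0. Arg2pi (G r / F r) \<le> Arg2pi (H r / F r)"
      by eventually_elim (simp add: ccw_dirs_def)
    then have "Arg2pi (v / u) \<le> Arg2pi (w / u)"
      by (intro tendsto_le[OF _ lims(2,1)]) simp_all
    then show "ccw_dirs u v w" using pos ne by (simp add: ccw_dirs_def)
  qed
qed

lemma ccw_dirs_sgn:
  assumes "u \<noteq> 0" "v \<noteq> 0" "w \<noteq> 0"
  shows "ccw_dirs (sgn u) (sgn v) (sgn w) \<longleftrightarrow> ccw_dirs u v w"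
proof -
  have "Arg2pi (sgn x / sgn u) = Arg2pi (x / u)" if "x \<noteq> 0" for x
  proof -
    have "sgn x / sgn u = of_real (norm u / norm x) * (x / u)"
      using that assms by (simp add: sgn_eq field_simps)
    then show ?thesis using that assms by (metis Arg2pi_times_of_real divide_pos_pos zero_less_norm_iff)
  qed
  then show ?thesis using assms by (simp add: ccw_dirs_def)
qed

text \<open>A circle about \<open>a\<close> meets the segment in at most one point, so the
  normalized hits are eventually constant.\<close>

lemma leaves_straight:
  assumes "path g" "pathstart g = a" "pathfinish g \<noteq> a" "path_image g \<subseteq> closed_segment a b"
  shows "leaves g (sgn (b - a))"
proof (rule leavesI)
  fix z assume z: "\<forall>\<^sub>F r in at_right 0. z r \<in> path_image g \<and> dist (pathstart g) (z r) = r"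
  have "\<forall>\<^sub>F r in at_right 0. (0::real) < r" by (simp add: eventually_at_right_less)
  with z have "\<forall>\<^sub>F r in at_right 0. sgn (b - a) = (z r - pathstart g) / of_real r"
  proof eventually_elim
    case (elim r)
    then have "z r \<in> closed_segment a b" using assms(4) by blast
    then obtain t where t: "0 \<le> t" "z r = a + of_real t * (b - a)"
      by (auto simp: closed_segment_def scaleR_conv_of_real algebra_simps)
    have r: "r = t * norm (b - a)" using elim t assms(2) by (simp add: dist_norm norm_mult norm_minus_commute)
    with elim t have "t > 0" by (metis less_eq_real_def mult_zero_left less_irrefl)
    then show ?case using t r assms(2) by (simp add: sgn_eq)
  qed
  then show "((\<lambda>r. (z r - pathstart g) / of_real r) \<longlongrightarrow> sgn (b - a)) (at_right 0)"
    by (rule Lim_transform_eventually[rotated]) simp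
qed (use assms in auto)

lemma leaves_linepath: "p \<noteq> q \<Longrightarrow> leaves (linepath p q) (sgn (q - p))"
  by (rule leaves_straight) simp_all

section \<open>The shape of a single segment\<close>

text \<open>A circular arc of radius \<open>\<rho>\<close> that leaves \<open>p\<close> in direction \<open>d\<close> and turns to the left
  (\<open>\<sigma> = 1\<close>) or to the right (\<open>\<sigma> = -1\<close>), at the angle \<open>\<theta>\<close>.\<close>

definition turn :: "complex \<Rightarrow> complex \<Rightarrow> real \<Rightarrow> real \<Rightarrow> real \<Rightarrow> complex" where
  "turn p d \<rho> \<sigma> \<theta> = p + of_real \<rho> * d * Complex (sin \<theta>) (\<sigma> * (1 - cos \<theta>))"

lemma dist_turn:
  assumes "norm d = 1" "\<rho> > 0" "\<sigma> \<in> {1, -1}"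
  shows "(dist p (turn p d \<rho> \<sigma> \<theta>))\<^sup>2 = 2 * \<rho>\<^sup>2 * (1 - cos \<theta>)"
proof -
  have "(dist p (turn p d \<rho> \<sigma> \<theta>))\<^sup>2 = \<rho>\<^sup>2 * ((sin \<theta>)\<^sup>2 + (1 - cos \<theta>)\<^sup>2)"
    using assms by (auto simp: turn_def dist_norm norm_mult power_mult_distrib cmod_power2)
  also have "(sin \<theta>)\<^sup>2 + (1 - cos \<theta>)\<^sup>2 = 2 * (1 - cos \<theta>)"
    using sin_cos_squared_add[of \<theta>] by (simp add: power2_eq_square algebra_simps)
  finally show ?thesis by simp
qed

lemma leaves_turn:
  assumes "path g" "pathstart g = p" "pathfinish g \<noteq> p"
    and img: "path_image g \<subseteq> turn p d \<rho> \<sigma> ` {0..3 * pi / 2}"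
    and d: "norm d = 1" "\<rho> > 0" "\<sigma> \<in> {1, -1}"
  shows "leaves g d"
proof (rule leavesI)
  fix z assume z: "\<forall>\<^sub>F r in at_right 0. z r \<in> path_image g \<and> dist (pathstart g) (z r) = r"
  have small: "\<forall>\<^sub>F r in at_right 0. r \<in> {0<..<\<rho>}"
    using d by (intro eventually_at_right_real) simp
  \<comment> \<open>A chord of length \<open>r\<close> from the start spans an angle \<theta> with r
    = 2 \<rho> sin (\<theta> / 2). The candidate is \<open>d\<close> rotated by half of that angle,
    written in terms of \<open>r\<close>.\<close>
  let ?w = "\<lambda>r. d * Complex (sqrt (1 - (r / (2 * \<rho>))\<^sup>2)) (\<sigma> * (r / (2 * \<rho>)))"
  from z small have "\<forall>\<^sub>F r in at_right 0. ?w r = (z r - pathstart g) / of_real r"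
  proof eventually_elim
    case (elim r)
    then have "z r \<in> turn p d \<rho> \<sigma> ` {0..3 * pi / 2}" using img by blast
    then obtain \<theta> where \<theta>: "0 \<le> \<theta>" "\<theta> \<le> 3 * pi / 2" "z r = turn p d \<rho> \<sigma> \<theta>"
      unfolding image_iff Bex_def atLeastAtMost_iff by blast
    have r: "r\<^sup>2 = 2 * \<rho>\<^sup>2 * (1 - cos \<theta>)"
      using dist_turn[OF d, of p \<theta>] elim \<theta> assms(2) by simp
    have c: "1 - cos \<theta> = r\<^sup>2 / (2 * \<rho>\<^sup>2)" using r d by (simp add: field_simps)
    have "r\<^sup>2 < \<rho>\<^sup>2" using elim by (intro power_strict_mono) auto
    then have "r\<^sup>2 / (2 * \<rho>\<^sup>2) < 1" using d(2) zero_le_power2[of \<rho>]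
      by (simp add: divide_less_eq) (metis add_strict_increasing2 mult_2 zero_le_power2)
    then have "cos \<theta> > 0" using c by linarith
    \<comment> \<open>From a quarter turn up to three quarters the cosine is not positive, so these
      points are at least sqrt 2 times \<rho> away from the start. Radii below \<rho> see only the
      first quarter.\<close>
    have "\<theta> < pi / 2"
    proof (rule ccontr)
      assume "\<not> \<theta> < pi / 2"
      then have "cos (\<theta> - pi) \<ge> 0" using \<theta> by (intro cos_ge_zero) auto
      then show False using \<open>cos \<theta> > 0\<close> by simp
    qed
    then have s0: "sin \<theta> \<ge> 0" using \<theta> by (intro sin_ge_zero) auto
    have "(sin \<theta>)\<^sup>2 = (1 - cos \<theta>) * (2 - (1 - cos \<theta>))"
      using sin_cos_squared_add[of \<theta>] by (simp add: power2_eq_square algebra_simps)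
    also have "\<dots> = (r / \<rho>)\<^sup>2 * (1 - (r / (2 * \<rho>))\<^sup>2)"
      unfolding c using d by (simp add: field_simps power2_eq_square)
    finally have "sin \<theta> = sqrt ((r / \<rho>)\<^sup>2 * (1 - (r / (2 * \<rho>))\<^sup>2))"
      using s0 by (metis abs_of_nonneg real_sqrt_abs)
    also have "\<dots> = r / \<rho> * sqrt (1 - (r / (2 * \<rho>))\<^sup>2)"
      using elim d by (simp add: real_sqrt_mult del: real_sqrt_abs2)
    finally have s: "sin \<theta> = r / \<rho> * sqrt (1 - (r / (2 * \<rho>))\<^sup>2)" .
    have "z r - pathstart g = of_real \<rho> * d * Complex (sin \<theta>) (\<sigma> * (1 - cos \<theta>))"
      using \<theta> assms(2) by (simp add: turn_def)
    also have "Complex (sin \<theta>) (\<sigma> * (1 - cos \<theta>)) =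
      of_real (r / \<rho>) * Complex (sqrt (1 - (r / (2 * \<rho>))\<^sup>2)) (\<sigma> * (r / (2 * \<rho>)))"
      unfolding s c by (simp add: complex_eq_iff power2_eq_square mult_ac)
    finally show ?case using elim d by simp
  qed
  moreover have "(?w \<longlongrightarrow> d * Complex (sqrt (1 - (0 / (2 * \<rho>))\<^sup>2)) (\<sigma> * (0 / (2 * \<rho>)))) (at_right 0)"
    using d by (intro tendsto_intros) auto
  then have "(?w \<longlongrightarrow> d) (at_right 0)"
    by (simp flip: one_complex.code)
  ultimately show "((\<lambda>r. (z r - pathstart g) / of_real r) \<longlongrightarrow> d) (at_right 0)"
    by (rule Lim_transform_eventually[rotated])
qed (use assms in auto)

lemma circle_point_turn:
  "c + of_real r * exp (\<i> * of_real (\<alpha> + \<sigma> * \<theta>)) =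
   turn (c + of_real r * exp (\<i> * of_real \<alpha>)) (of_real \<sigma> * \<i> * exp (\<i> * of_real \<alpha>)) r \<sigma> \<theta>"
  if "\<sigma> \<in> {1, -1}" for \<sigma> :: real
proof -
  have "exp (\<i> * of_real (\<alpha> + \<sigma> * \<theta>)) = exp (\<i> * of_real \<alpha>) * cis (\<sigma> * \<theta>)"
    by (simp add: exp_add distrib_left cis_conv_exp)
  also have "cis (\<sigma> * \<theta>) = 1 + of_real \<sigma> * \<i> * Complex (sin \<theta>) (\<sigma> * (1 - cos \<theta>))"
    using that by (auto simp: complex_eq_iff)
  finally show ?thesis by (simp add: turn_def algebra_simps)
qed

lemma start_dir_linepath: "start_dir (linepath a b) = sgn (b - a)"
  by (simp add: start_dir_def)

lemma start_dir_part_circlepath: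
  assumes "r > 0"
  shows "start_dir (part_circlepath c r \<alpha> \<beta>) = of_real (sgn (\<beta> - \<alpha>)) * \<i> * exp (\<i> * of_real \<alpha>)"
proof -
  have "start_dir (part_circlepath c r \<alpha> \<beta>) = sgn (\<i> * of_real r * of_real (\<beta> - \<alpha>) * exp (\<i> * of_real \<alpha>))"
    by (simp add: start_dir_def vector_derivative_part_circlepath linepath_def)
  also have "\<dots> = of_real (sgn (\<beta> - \<alpha>)) * \<i> * exp (\<i> * of_real \<alpha>)"
    using assms by (simp add: sgn_mult sgn_of_real sgn_eq[of "exp _"] sgn_eq[of \<i>] del: of_real_diff)
  finally show ?thesis .
qed

lemma path_image_part_circlepath_turn:
  fixes \<alpha> \<beta> :: real
  defines "\<sigma> \<equiv> sgn (\<beta> - \<alpha>)"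
  assumes "\<alpha> \<noteq> \<beta>"
  shows "path_image (part_circlepath c r \<alpha> \<beta>) =
    turn (c + of_real r * exp (\<i> * of_real \<alpha>)) (of_real \<sigma> * \<i> * exp (\<i> * of_real \<alpha>)) r \<sigma> ` {0..\<bar>\<beta> - \<alpha>\<bar>}"
proof -
  have \<sigma>: "\<sigma> \<in> {1, -1}" using assms by (auto simp: sgn_if)
  have seg: "closed_segment \<alpha> \<beta> = (\<lambda>\<theta>. \<alpha> + \<sigma> * \<theta>) ` {0..\<bar>\<beta> - \<alpha>\<bar>}"
  proof (cases "\<alpha> < \<beta>")
    case True
    then have "\<sigma> = 1" by (simp add: \<sigma>_def)
    then show ?thesis using True by (simp add: closed_segment_eq_real_ivl)
  next
    case False
    then have "\<sigma> = -1" "\<beta> < \<alpha>" using assms by (auto simp: \<sigma>_def)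
    then show ?thesis using image_diff_atLeastAtMost[of \<alpha> 0 "\<alpha> - \<beta>"]
      by (simp add: closed_segment_eq_real_ivl)
  qed
  show ?thesis
    unfolding path_image_part_circlepath' seg image_image cis_conv_exp circle_point_turn[OF \<sigma>] ..
qed

text \<open>\<open>leaves_straight\<close> and \<open>leaves_turn\<close> look only at the image, so
  the direction of the segment passes to every arc with the same image and start point.\<close>

lemma leaves_smooth_segment:
  assumes s: "smooth_segment s" and g: "arc g" "path_image g = path_image s" "pathstart g = pathstart s"
  shows "leaves g (start_dir s)"
proof -
  have g': "path g" "pathstart g \<noteq> pathfinish g"
    using g(1) arc_distinct_ends[of g] by (auto simp: arc_imp_path)
  from s consider a b where "a \<noteq> b" "s = linepath a b"
    | c r \<alpha> \<beta> where "0 < r" "\<bar>\<beta> - \<alpha>\<bar> \<in> {pi / 2, pi, 3 * pi / 2}" "s = part_circlepath c r \<alpha> \<beta>"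
    unfolding smooth_segment_def by blast
  then show ?thesis
  proof cases
    case 1
    then show ?thesis
      using g g' leaves_straight[of g a b] by (simp add: start_dir_linepath)
  next
    case 2
    define \<sigma> where "\<sigma> = sgn (\<beta> - \<alpha>)"
    have ne: "\<alpha> \<noteq> \<beta>" using 2 pi_gt_zero by auto
    then have \<sigma>: "\<sigma> \<in> {1, -1}" by (auto simp: \<sigma>_def sgn_if)
    have dir: "start_dir s = of_real \<sigma> * \<i> * exp (\<i> * of_real \<alpha>)"
      using 2 by (simp add: start_dir_part_circlepath \<sigma>_def)
    show ?thesis
    proof (rule leaves_turn[where \<rho> = r and \<sigma> = \<sigma>, OF g'(1) refl])
      have "\<bar>\<beta> - \<alpha>\<bar> \<le> 3 * pi / 2" using 2 pi_gt_zero by auto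
      then show "path_image g \<subseteq> turn (pathstart g) (start_dir s) r \<sigma> ` {0..3 * pi / 2}"
        unfolding g dir unfolding 2 using path_image_part_circlepath_turn[OF ne, of c r]
        by (auto simp: \<sigma>_def)
      show "norm (start_dir s) = 1" using \<sigma> unfolding dir by (auto simp: norm_mult)
    qed (use g' 2 \<sigma> in auto)
  qed
qed

text \<open>What is used of a single segment that leaves \<open>p\<close> through the port \<open>d\<close> and \<open>q\<close> through the
  port \<open>e\<close>: line segment, quarter arc, semicircle and three-quarter arc; \<open>s = \<i>\<close> for left turns
  and \<open>s = -\<i>\<close> for right turns.\<close>

inductive joins :: "complex \<Rightarrow> complex \<Rightarrow> complex \<Rightarrow> complex \<Rightarrow> complex set \<Rightarrow> bool"
  for d e p q X where
  line: "0 < r \<Longrightarrow> e = - d \<Longrightarrow> q = p + of_real r * d \<Longrightarrow> X = closed_segment p q \<Longrightarrow> joins d e p q X"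
| quarter: "0 < r \<Longrightarrow> s \<in> {\<i>, -\<i>} \<Longrightarrow> e = - s * d \<Longrightarrow> q = p + of_real r * d * (1 + s) \<Longrightarrow> joins d e p q X"
| semicircle: "0 < r \<Longrightarrow> s \<in> {\<i>, -\<i>} \<Longrightarrow> e = d \<Longrightarrow> q = p + 2 * of_real r * s * d \<Longrightarrow>
    p + of_real r * d * (1 + s) \<in> X \<Longrightarrow>
    (\<And>z. z \<in> X \<Longrightarrow> \<exists>x y. 0 \<le> x \<and> 0 \<le> y \<and> y \<le> 2 * r \<and> z = p + d * (of_real x + of_real y * s)) \<Longrightarrow>
    joins d e p q X"
| three_quarter: "0 < r \<Longrightarrow> s \<in> {\<i>, -\<i>} \<Longrightarrow> e = s * d \<Longrightarrow> q = p + of_real r * d * (s - 1) \<Longrightarrow>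
    p + 2 * of_real r * s * d \<in> X \<Longrightarrow> joins d e p q X"

lemma joins_linepath:
  assumes "a \<noteq> b"
  shows "joins (start_dir (linepath a b)) (start_dir (linepath b a)) a b (closed_segment a b)"
proof -
  have "b = a + of_real (norm (b - a)) * sgn (b - a)"
    using assms by (simp add: sgn_eq)
  moreover have "sgn (a - b) = - sgn (b - a)" by (simp add: sgn_minus[symmetric])
  ultimately show ?thesis
    using assms unfolding start_dir_linepath by (intro joins.line[of "norm (b - a)"]) auto
qed

lemma joins_part_circlepath:
  fixes c :: complex and r \<alpha> \<beta> :: real
  assumes r: "r > 0" and arc: "\<bar>\<beta> - \<alpha>\<bar> \<in> {pi / 2, pi, 3 * pi / 2}"
  defines "g \<equiv> part_circlepath c r \<alpha> \<beta>"
  shows "joins (start_dir g) (start_dir (reversepath g)) (pathstart g) (pathfinish g) (path_image g)"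
proof -
  define \<sigma> where "\<sigma> = sgn (\<beta> - \<alpha>)"
  define \<Theta> where "\<Theta> = \<bar>\<beta> - \<alpha>\<bar>"
  define s where "s = of_real \<sigma> * \<i>"
  have ne: "\<alpha> \<noteq> \<beta>" using assms pi_gt_zero by auto
  then have \<sigma>: "\<sigma> \<in> {1, -1}" by (auto simp: \<sigma>_def sgn_if)
  then have s: "s \<in> {\<i>, -\<i>}" by (auto simp: s_def)
  have \<beta>: "\<beta> = \<alpha> + \<sigma> * \<Theta>" by (auto simp: \<sigma>_def \<Theta>_def sgn_if)
  define d where "d = of_real \<sigma> * \<i> * exp (\<i> * of_real \<alpha>)"
  define p where "p = c + of_real r * exp (\<i> * of_real \<alpha>)"
  have d: "start_dir g = d" using r by (simp add: g_def d_def \<sigma>_def start_dir_part_circlepath)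
  have p: "pathstart g = p" by (simp add: g_def p_def)
  have q: "pathfinish g = turn p d r \<sigma> \<Theta>"
    using circle_point_turn[OF \<sigma>, of c r \<alpha> \<Theta>] by (simp add: g_def p_def d_def \<beta>)
  have X: "path_image g = turn p d r \<sigma> ` {0..\<Theta>}"
    unfolding g_def p_def d_def \<sigma>_def \<Theta>_def by (rule path_image_part_circlepath_turn[OF ne])
  have "sgn (\<alpha> - \<beta>) = - \<sigma>" unfolding \<sigma>_def by (simp add: sgn_if)
  then have "start_dir (reversepath g) = - of_real \<sigma> * \<i> * exp (\<i> * of_real \<beta>)"
    using r by (simp add: g_def start_dir_part_circlepath)
  also have "exp (\<i> * of_real \<beta>) = exp (\<i> * of_real \<alpha>) * cis (\<sigma> * \<Theta>)"
    by (simp add: \<beta> exp_add distrib_left cis_conv_exp)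
  finally have e: "start_dir (reversepath g) = - d * cis (\<sigma> * \<Theta>)" by (simp add: d_def)
  have sc: "Complex x (\<sigma> * y) = of_real x + of_real y * s" for x y
    by (simp add: s_def complex_eq_iff)
  have turn: "turn p d r \<sigma> \<theta> = p + of_real r * d * (of_real (sin \<theta>) + of_real (1 - cos \<theta>) * s)" for \<theta>
    unfolding turn_def sc ..
  have c32: "cos (3 * pi / 2) = 0" "sin (3 * pi / 2) = -1"
    using cos_add[of pi "pi / 2"] sin_add[of pi "pi / 2"] by simp_all
  consider "\<Theta> = pi / 2" | "\<Theta> = pi" | "\<Theta> = 3 * pi / 2" using assms(2) \<Theta>_def by auto
  then show ?thesis
  proof cases
    case 1
    have "start_dir (reversepath g) = - s * d"
      using \<sigma> unfolding e 1 s_def by (auto simp: complex_eq_iff)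
    moreover have "pathfinish g = p + of_real r * d * (1 + s)"
      unfolding q turn 1 by simp
    ultimately show ?thesis unfolding d p by (rule joins.quarter[OF r s])
  next
    case 2
    have "start_dir (reversepath g) = d"
      using \<sigma> unfolding e 2 by (auto simp: complex_eq_iff)
    moreover have "pathfinish g = p + 2 * of_real r * s * d"
      unfolding q turn 2 by simp
    \<comment> \<open>The apex of the semicircle; over a diagonal of the square this is a third
      vertex.\<close>
    moreover have "turn p d r \<sigma> (pi / 2) \<in> path_image g" unfolding X 2 by (rule imageI) simp
    then have "p + of_real r * d * (1 + s) \<in> path_image g" unfolding turn by simp
    moreover have "\<exists>x y. 0 \<le> x \<and> 0 \<le> y \<and> y \<le> 2 * r \<and> z = p + d * (of_real x + of_real y * s)"
      if "z \<in> path_image g" for z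
    proof -
      have "z \<in> turn p d r \<sigma> ` {0..pi}" using that unfolding X 2 .
      then obtain \<theta> where "z = turn p d r \<sigma> \<theta>" "\<theta> \<in> {0..pi}" by (rule imageE)
      then have \<theta>: "0 \<le> \<theta>" "\<theta> \<le> pi" "z = turn p d r \<sigma> \<theta>" by simp_all
      have "0 \<le> r * sin \<theta>" using \<theta> r by (simp add: sin_ge_zero)
      moreover have "0 \<le> r * (1 - cos \<theta>)" "r * (1 - cos \<theta>) \<le> r * 2"
        using r cos_ge_minus_one[of \<theta>] by (auto intro!: mult_left_mono)
      moreover have "z = p + d * (of_real (r * sin \<theta>) + of_real (r * (1 - cos \<theta>)) * s)"
        using \<theta> by (simp add: turn algebra_simps)
      ultimately show ?thesis
        by (intro exI[of _ "r * sin \<theta>"] exI[of _ "r * (1 - cos \<theta>)"] conjI)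
          (simp_all only: mult.commute[of 2 r])
    qed
    ultimately show ?thesis unfolding d p by (rule joins.semicircle[OF r s])
  next
    case 3
    have "cis (\<sigma> * \<Theta>) = - s"
      using \<sigma> c32 unfolding 3 s_def by (auto simp: complex_eq_iff)
    then have "start_dir (reversepath g) = s * d" unfolding e by simp
    moreover have "pathfinish g = p + of_real r * d * (s - 1)"
      unfolding q turn 3 c32 by simp
    \<comment> \<open>The point opposite the start on the circle; it serves to exclude a
      three-quarter arc as a side of a block.\<close>
    moreover have "turn p d r \<sigma> pi \<in> path_image g" unfolding X 3 by (rule imageI) simp
    then have "p + 2 * of_real r * s * d \<in> path_image g" unfolding turn by (simp add: mult_ac)
    ultimately show ?thesis unfolding d p by (rule joins.three_quarter[OF r s])
  qed
qed

lemma smooth_segment_reversepath: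
  assumes "smooth_segment s" shows "smooth_segment (reversepath s)"
proof -
  from assms consider a b where "a \<noteq> b" "Re a = Re b \<or> Im a = Im b" "s = linepath a b"
    | c r \<alpha> \<beta> where "0 < r" "\<bar>\<beta> - \<alpha>\<bar> \<in> {pi / 2, pi, 3 * pi / 2}" "s = part_circlepath c r \<alpha> \<beta>"
    unfolding smooth_segment_def by blast
  then show ?thesis
  proof cases
    case 1
    then have "b \<noteq> a" "Re b = Re a \<or> Im b = Im a" "reversepath s = linepath b a" by auto
    then show ?thesis unfolding smooth_segment_def by blast
  next
    case 2
    then have "\<bar>\<alpha> - \<beta>\<bar> \<in> {pi / 2, pi, 3 * pi / 2}" "reversepath s = part_circlepath c r \<beta> \<alpha>"
      by (simp_all only: abs_minus_commute[of \<alpha>] reversepath_part_circlepath)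
    then show ?thesis using \<open>0 < r\<close> unfolding smooth_segment_def by blast
  qed
qed

lemma joins_smooth_segment:
  assumes "smooth_segment s"
  shows "joins (start_dir s) (start_dir (reversepath s)) (pathstart s) (pathfinish s) (path_image s)"
proof -
  from assms consider a b where "a \<noteq> b" "s = linepath a b"
    | c r \<alpha> \<beta> where "0 < r" "\<bar>\<beta> - \<alpha>\<bar> \<in> {pi / 2, pi, 3 * pi / 2}" "s = part_circlepath c r \<alpha> \<beta>"
    unfolding smooth_segment_def by blast
  then show ?thesis
  proof cases
    case 1
    then show ?thesis using joins_linepath[of a b] by simp
  next
    case 2
    then show ?thesis using joins_part_circlepath[of r \<beta> \<alpha> c] by simp
  qed
qed

text \<open>The ports of an \<open>SC\<^sub>1\<close>-layout are read off from the curves alone: each is the direction in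
  which the curve leaves the vertex.\<close>

lemma SC_layout_1_ports:
  assumes "SC_layout 1 V E L"
  obtains P where
    "\<And>u v. {u, v} \<in> E \<Longrightarrow> leaves (curve L u v) (P u v)"
    "\<And>u v. {u, v} \<in> E \<Longrightarrow> P u v \<in> ports"
    "\<And>u v w. {u, v} \<in> E \<Longrightarrow> {u, w} \<in> E \<Longrightarrow> v \<noteq> w \<Longrightarrow> P u v \<noteq> P u w"
    "\<And>u v. {u, v} \<in> E \<Longrightarrow> joins (P u v) (P v u) (pos L u) (pos L v) (path_image (curve L u v))"
proof -
  from assms have draw: "is_drawing V E L" by (simp add: SC_layout_def)
  from assms obtain S where S':
    "\<forall>u v. {u, v} \<in> E \<longrightarrow> smooth_chain (S u v) (curve L u v) \<and> length (S u v) \<le> 1 \<and> start_dir (hd (S u v)) \<in> ports"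
    and S4: "\<forall>u v w. {u, v} \<in> E \<longrightarrow> {u, w} \<in> E \<longrightarrow> v \<noteq> w \<longrightarrow> start_dir (hd (S u v)) \<noteq> start_dir (hd (S u w))"
    unfolding SC_layout_def by (elim conjE exE) (rule that)
  have S: "smooth_chain (S u v) (curve L u v)" "length (S u v) \<le> 1" "start_dir (hd (S u v)) \<in> ports"
    if "{u, v} \<in> E" for u v
    using S'[rule_format, OF that] by simp_all
  define s where "s u v = hd (S u v)" for u v
  have curve: "arc (curve L u v)" "pathstart (curve L u v) = pos L u" "pathfinish (curve L u v) = pos L v"
    "curve L v u = reversepath (curve L u v)" if "{u, v} \<in> E" for u v
    using conjunct1[OF conjunct2[OF draw[unfolded is_drawing_def]], rule_format, OF that] by simp_all
  have seg: "smooth_segment (s u v)" "pathstart (s u v) = pos L u" "pathfinish (s u v) = pos L v"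
    "path_image (s u v) = path_image (curve L u v)" if e: "{u, v} \<in> E" for u v
  proof -
    have "S u v = [s u v]"
      using S(1)[OF e] S(2)[OF e] unfolding s_def smooth_chain_def
      by (cases "S u v") (auto simp: Suc_le_eq)
    then show "smooth_segment (s u v)" "pathstart (s u v) = pos L u" "pathfinish (s u v) = pos L v"
      "path_image (s u v) = path_image (curve L u v)"
      using S(1)[OF e] curve[OF e] unfolding smooth_chain_def by auto
  qed
  have lv: "leaves (curve L u v) (start_dir (s u v))" if e: "{u, v} \<in> E" for u v
    using seg[OF e] curve(1,2)[OF e] by (intro leaves_smooth_segment) auto
  \<comment> \<open>The segments chosen for the two traversals of an edge are unrelated, but both
    determine the direction in which the same curve leaves \<open>v\<close>.\<close>
  have rev: "start_dir (reversepath (s u v)) = start_dir (s v u)" if e: "{u, v} \<in> E" for u v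
  proof -
    have e': "{v, u} \<in> E" using e by (simp add: insert_commute)
    have "leaves (curve L v u) (start_dir (reversepath (s u v)))"
      using seg[OF e] curve(3,4)[OF e] curve(1)[OF e']
      by (intro leaves_smooth_segment smooth_segment_reversepath) auto
    then show ?thesis using lv[OF e'] by (rule leaves_unique)
  qed
  show ?thesis
  proof (rule that[of "\<lambda>u v. start_dir (s u v)"])
    fix u v assume e: "{u, v} \<in> E"
    show "joins (start_dir (s u v)) (start_dir (s v u)) (pos L u) (pos L v) (path_image (curve L u v))"
      using joins_smooth_segment[OF seg(1)[OF e]] seg[OF e] rev[OF e] by simp
    show "leaves (curve L u v) (start_dir (s u v))" by (rule lv[OF e])
    show "start_dir (s u v) \<in> ports" unfolding s_def by (rule S(3)[OF e])
  next
    fix u v w assume "{u, v} \<in> E" "{u, w} \<in> E" "v \<noteq> w"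
    then show "start_dir (s u v) \<noteq> start_dir (s u w)" unfolding s_def by (rule S4[rule_format])
  qed
qed

section \<open>Two crossing diagonals force a circle\<close>

definition axis_aligned :: "complex \<Rightarrow> complex \<Rightarrow> bool" where
  "axis_aligned p q \<longleftrightarrow> Re p = Re q \<or> Im p = Im q"

definition diagonal :: "complex \<Rightarrow> complex \<Rightarrow> bool" where
  "diagonal p q \<longleftrightarrow> \<bar>Re p - Re q\<bar> = \<bar>Im p - Im q\<bar>"

text \<open>Membership in \<open>\<real>\<close> tells horizontal ports from vertical ones; only
  arcs of one or three quarters exchange the two kinds.\<close>

lemma joins_parity:
  assumes "joins d e p q X" "d \<in> ports" "e \<in> ports"
  shows "if d \<in> \<real> \<longleftrightarrow> e \<in> \<real> then axis_aligned p q else diagonal p q"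
  using assms(1)
  by cases (use assms(2,3) in \<open>auto simp: ports_def axis_aligned_def diagonal_def complex_is_Real_iff\<close>)

lemma abs_eq_abs_midpoint:
  fixes x y z :: real
  shows "x \<noteq> z \<Longrightarrow> \<bar>x - y\<bar> = \<bar>z - y\<bar> \<Longrightarrow> 2 * y = x + z"
  by (auto simp: abs_eq_iff)

text \<open>A point seen diagonally from both \<open>A\<close> and \<open>C\<close> lies on their
  perpendicular bisector, at half their distance from the midpoint. There are only two such points,
  and \<open>B\<close> and \<open>D\<close> take both.\<close>

lemma diamond:
  assumes "axis_aligned A C" "A \<noteq> C" "B \<noteq> D"
    "diagonal A B" "diagonal C B" "diagonal C D" "diagonal A D"
  shows "A + C = B + D" "D - B = \<i> * (C - A) \<or> D - B = - \<i> * (C - A)"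
proof -
  have "A + C = B + D \<and> (D - B = \<i> * (C - A) \<or> D - B = - \<i> * (C - A))"
  proof (cases "Re A = Re C")
    case True
    then have "Im A \<noteq> Im C" using assms(2) by (simp add: complex_eq_iff)
    then have m: "2 * Im B = Im A + Im C" "2 * Im D = Im A + Im C"
      using assms True unfolding diagonal_def by (metis abs_eq_abs_midpoint)+
    then have "Re B \<noteq> Re D" using assms(3) by (simp add: complex_eq_iff)
    moreover have "\<bar>2 * (Re A - Re B)\<bar> = \<bar>Im A - Im C\<bar>" "\<bar>2 * (Re A - Re D)\<bar> = \<bar>Im A - Im C\<bar>"
      using assms(4,7) m unfolding diagonal_def abs_mult by simp_all argo+
    ultimately show ?thesis using m True by (auto simp: complex_eq_iff abs_eq_iff)
  next
    case False
    then have I: "Im A = Im C" using assms(1) by (simp add: axis_aligned_def)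
    have m: "2 * Re B = Re A + Re C" "2 * Re D = Re A + Re C"
      using assms False I unfolding diagonal_def by (metis abs_eq_abs_midpoint)+
    then have "Im B \<noteq> Im D" using assms(3) by (simp add: complex_eq_iff)
    moreover have "\<bar>2 * (Im A - Im B)\<bar> = \<bar>Re A - Re C\<bar>" "\<bar>2 * (Im A - Im D)\<bar> = \<bar>Re A - Re C\<bar>"
      using assms(4,7) m unfolding diagonal_def abs_mult by simp_all argo+
    ultimately show ?thesis using m I by (auto simp: complex_eq_iff abs_eq_iff)
  qed
  then show "A + C = B + D" "D - B = \<i> * (C - A) \<or> D - B = - \<i> * (C - A)" by auto
qed

text \<open>If the three points formed a right angle, its hypotenuse would not be
  axis-parallel.\<close>

lemma axis_aligned3:
  assumes "axis_aligned P Q" "axis_aligned Q R" "axis_aligned P R" "P \<noteq> Q" "Q \<noteq> R" "P \<noteq> R"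
  shows "Re P = Re Q \<and> Re Q = Re R \<or> Im P = Im Q \<and> Im Q = Im R"
  using assms unfolding axis_aligned_def complex_eq_iff by metis

text \<open>On an axis-parallel line at most two points see \<open>W\<close> diagonally, mirror
  images about its projection. This excludes that exactly one of four vertices has the other port
  parity.\<close>

lemma no_diagonal_fan:
  assumes "axis_aligned P Q" "axis_aligned Q R" "axis_aligned P R" "P \<noteq> Q" "Q \<noteq> R" "P \<noteq> R"
    and d: "diagonal P W" "diagonal Q W" "diagonal R W"
  shows False
  using axis_aligned3[OF assms(1-6)]
proof
  assume *: "Re P = Re Q \<and> Re Q = Re R"
  then have "Im P \<noteq> Im Q" "Im Q \<noteq> Im R" "Im P \<noteq> Im R" using assms by (auto simp: complex_eq_iff)
  then show False using d * unfolding diagonal_def by (metis abs_eq_abs_midpoint add_left_cancel)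
next
  assume *: "Im P = Im Q \<and> Im Q = Im R"
  then have "Re P \<noteq> Re Q" "Re Q \<noteq> Re R" "Re P \<noteq> Re R" using assms by (auto simp: complex_eq_iff)
  then show False using d * unfolding diagonal_def by (metis abs_eq_abs_midpoint add_left_cancel)
qed

lemma diagonal_commute: "diagonal p q \<longleftrightarrow> diagonal q p"
  by (auto simp: diagonal_def abs_minus_commute)

section \<open>Edges whose ports at the two ends are parallel\<close>

lemma joins_straight:
  assumes j: "joins d e p q X" "d \<in> ports" "e \<in> ports" "d \<in> \<real> \<longleftrightarrow> e \<in> \<real>"
    and avoid: "w \<notin> X" "z \<notin> X"
    and diam: "p + q = w + z" "z - w = \<i> * (q - p) \<or> z - w = - \<i> * (q - p)"
  shows "e = - d" "\<exists>r>0. q = p + of_real r * d" "X = closed_segment p q"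
proof -
  have turn: False if "e = s * d" "s \<in> {\<i>, -\<i>}" for s
    using that j by (auto simp: ports_def complex_is_Real_iff complex_eq_iff[of _ 1])
  have semi: False if s: "r > 0" "s \<in> {\<i>, -\<i>}" "q = p + 2 * of_real r * s * d"
    "p + of_real r * d * (1 + s) \<in> X" for r s
  proof -
    \<comment> \<open>Doubled, to avoid halves: \<open>w\<close> and \<open>z\<close> end the
      diameter perpendicular to the one from \<open>p\<close> to \<open>q\<close>, and the apex of
      either semicircle is one of them.\<close>
    have "2 * w = p + q - (z - w)" "2 * z = p + q + (z - w)" using diam(1) by (simp_all add: algebra_simps)
    then have "2 * w = 2 * (p + of_real r * d * (1 + s)) \<or> 2 * z = 2 * (p + of_real r * d * (1 + s))"
      using diam(2) s by (auto simp: algebra_simps)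
    then have "w = p + of_real r * d * (1 + s) \<or> z = p + of_real r * d * (1 + s)"
      by (simp only: mult_left_cancel[OF zero_neq_numeral[symmetric]])
    then show False using avoid s(4) by blast
  qed
  have "e = - d \<and> (\<exists>r>0. q = p + of_real r * d) \<and> X = closed_segment p q"
    using j(1)
  proof cases
    case (quarter r s)
    then show ?thesis using turn[of "- s"] by auto
  qed (use semi turn in blast)+
  then show "e = - d" "\<exists>r>0. q = p + of_real r * d" "X = closed_segment p q" by auto
qed

lemma joins_collinear:
  assumes "joins d e p q X" "d \<in> ports" "e = d \<or> e = - d"
  shows "e = - d \<and> (\<exists>r>0. q = p + of_real r * d) \<or> e = d \<and> (\<exists>r. r \<noteq> 0 \<and> q = p + \<i> * of_real r * d)"
  using assms(1)
proof cases
  case (semicircle r s)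
  define t where "t = (if s = \<i> then 2 * r else - 2 * r)"
  have "t \<noteq> 0" using semicircle(1) by (simp add: t_def)
  moreover have "q = p + \<i> * of_real t * d" using semicircle(2,4) by (auto simp: t_def)
  ultimately show ?thesis using semicircle(3) by blast
next
  case (quarter r s)
  then show ?thesis using assms(2,3) by (auto simp: ports_def complex_eq_iff)
next
  case (three_quarter r s)
  then show ?thesis using assms(2,3) by (auto simp: ports_def complex_eq_iff)
qed blast

text \<open>Which two opposite edges of a block become the diagonals of the square is not known in
  advance. Two of the three choices are refuted by the common point of \<open>X\<close> and
  \<open>Y\<close>, the third is described by the other conclusions.\<close>

lemma crossing_diagonals:
  assumes ports: "d \<in> ports" "e \<in> ports" "d' \<in> ports" "e' \<in> ports"
    and j: "joins d e p q X" "joins d' e' w z Y"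
    and par: "d \<in> \<real> \<longleftrightarrow> e \<in> \<real>" "d' \<in> \<real> \<longleftrightarrow> e' \<in> \<real>"
    and ne: "p \<noteq> q" "w \<noteq> z"
    and diag: "diagonal p w" "diagonal q w" "diagonal q z" "diagonal p z"
    and avoid: "w \<notin> X" "z \<notin> X" "p \<notin> Y" "q \<notin> Y"
  shows "X \<inter> Y \<noteq> {}" "e = - d" "e' = - d'" "p + q = w + z"
    "\<exists>r>0. q = p + of_real r * d" "\<exists>r>0. z = w + of_real r * d'"
proof -
  have "axis_aligned p q" using joins_parity[OF j(1) ports(1,2)] par by simp
  note diam = diamond[OF this ne diag]
  have diam': "q - p = \<i> * (z - w) \<or> q - p = - \<i> * (z - w)" using diam(2) by auto
  note st = joins_straight[OF j(1) ports(1,2) par(1) avoid(1,2) diam]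
  note st' = joins_straight[OF j(2) ports(3,4) par(2) avoid(3,4) diam(1)[symmetric] diam']
  have "midpoint p q = midpoint w z" using diam(1) by (simp add: midpoint_def)
  moreover have "midpoint p q \<in> X" unfolding st(3) by (rule midpoint_in_closed_segment)
  moreover have "midpoint w z \<in> Y" unfolding st'(3) by (rule midpoint_in_closed_segment)
  ultimately show "X \<inter> Y \<noteq> {}" by auto
  show "e = - d" "e' = - d'" "p + q = w + z"
    "\<exists>r>0. q = p + of_real r * d" "\<exists>r>0. z = w + of_real r * d'"
    by (rule st st' diam)+
qed

text \<open>Division by \<open>d\<close> turns the port \<open>d\<close> into East. A line segment
  then leads strictly to the right, a semicircle to a point straight above or below.\<close>

lemma joins_frame:
  assumes "joins d e p q X" "d \<in> ports" "e = d \<or> e = - d"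
  shows "e = - d \<and> Re (p / d) < Re (q / d) \<and> Im (q / d) = Im (p / d) \<or>
         e = d \<and> Re (q / d) = Re (p / d) \<and> Im (q / d) \<noteq> Im (p / d)"
proof -
  have "d \<noteq> 0" using assms(2) by (auto simp: ports_def)
  then show ?thesis using joins_collinear[OF assms] by (auto simp: add_divide_distrib)
qed

text \<open>With A, B, C, D in cyclic order, \<open>pa\<close> is the port of \<open>A\<close>
  towards its predecessor \<open>D\<close>, \<open>\<i> * pa\<close> the one towards the opposite
  vertex and \<open>- pa\<close> the one towards its successor; \<open>pb\<close>,
  \<open>pc\<close>, \<open>pd\<close> likewise. Each edge is a sign condition in the frame of
  \<open>pa\<close>.\<close>

lemma K4_not_collinear:
  assumes ports: "pa \<in> ports" "pb = pa \<or> pb = - pa" "pc = pa \<or> pc = - pa" "pd = pa \<or> pd = - pa"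
    and j: "joins (- pa) pb A B XAB" "joins (\<i> * pa) (\<i> * pc) A C XAC" "joins pa (- pd) A D XAD"
      "joins (- pb) pc B C XBC" "joins (\<i> * pb) (\<i> * pd) B D XBD" "joins (- pc) pd C D XCD"
    and al: "axis_aligned A B" "axis_aligned A C" "axis_aligned A D" "axis_aligned B C" "axis_aligned B D" "axis_aligned C D"
    and ne: "A \<noteq> B" "A \<noteq> C" "A \<noteq> D" "B \<noteq> C" "B \<noteq> D" "C \<noteq> D"
  shows False
proof -
  have p: "- pa \<in> ports" "\<i> * pa \<in> ports" "- pb \<in> ports" "- pc \<in> ports"
    using ports by (auto simp: ports_def)
  have pa: "pa \<noteq> 0" "- pa \<noteq> pa" "pa \<noteq> - pa" using ports(1) by (auto simp: ports_def complex_eq_iff)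
  define k where "k z = Re (z / pa)" for z
  define h where "h z = Im (z / pa)" for z
  have kh: "Re (z / pa) = k z" "Im (z / pa) = h z" "Re (z / (- pa)) = - k z" "Im (z / (- pa)) = - h z"
    "Re (z / (\<i> * pa)) = h z" "Im (z / (\<i> * pa)) = - k z" for z
  proof -
    have "z / (\<i> * pa) = - \<i> * (z / pa)" using pa(1) by (simp add: field_simps)
    then show "Re (z / (\<i> * pa)) = h z" "Im (z / (\<i> * pa)) = - k z" by (simp_all add: k_def h_def del: times_divide_eq_right mult_minus_left)
  qed (simp_all add: k_def h_def)
  have line: "k A = k B \<and> k B = k C \<and> k C = k D \<or> h A = h B \<and> h B = h C \<and> h C = h D"
    using axis_aligned3[OF al(1,4,2) ne(1,4,2)] axis_aligned3[OF al(1,5,3) ne(1,5,3)] ne(1) ports(1)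
    unfolding k_def h_def ports_def complex_eq_iff by (elim insertE; simp; argo)
  have AB: "pb = pa \<and> k B < k A \<and> h B = h A \<or> pb = - pa \<and> k B = k A \<and> h B \<noteq> h A"
    using joins_frame[OF j(1) p(1)] ports(2) unfolding kh by auto
  have AC: "pc = - pa \<and> h A < h C \<and> k C = k A \<or> pc = pa \<and> h C = h A \<and> k C \<noteq> k A"
    using joins_frame[OF j(2) p(2)] ports(3) pa unfolding kh by auto
  have AD: "pd = pa \<and> k A < k D \<and> h D = h A \<or> pd = - pa \<and> k D = k A \<and> h D \<noteq> h A"
    using joins_frame[OF j(3) ports(1)] ports(4) unfolding kh by auto
  have BC: "pb = pa \<Longrightarrow> pc = pa \<and> k C < k B \<and> h C = h B \<or> pc = - pa \<and> k C = k B \<and> h C \<noteq> h B"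
    "pb = - pa \<Longrightarrow> pc = - pa \<and> k B < k C \<and> h C = h B \<or> pc = pa \<and> k C = k B \<and> h C \<noteq> h B"
    using joins_frame[OF j(4) p(3)] ports(3) by (auto simp: kh)
  have CD: "pc = pa \<Longrightarrow> pd = pa \<and> k D < k C \<and> h D = h C \<or> pd = - pa \<and> k D = k C \<and> h D \<noteq> h C"
    "pc = - pa \<Longrightarrow> pd = - pa \<and> k C < k D \<and> h D = h C \<or> pd = pa \<and> k D = k C \<and> h D \<noteq> h C"
    using joins_frame[OF j(6) p(4)] ports(4) by (auto simp: kh)
  show False
    using AB
  proof (elim disjE conjE)
    \<comment> \<open>The common line has constant \<open>h\<close>, which forces all four ports to
      agree. The sides then give k D < k C < k B < k A < k D.\<close>
    assume "pb = pa" "k B < k A" "h B = h A"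
    then show False using line AC AD BC(1) CD(1) pa by auto
  next
    \<comment> \<open>The common line has constant \<open>k\<close>. Edge AC then forces
      \<open>pc = - pa\<close>, which makes BC a segment that changes \<open>k\<close>.\<close>
    assume "pb = - pa" "k B = k A" "h B \<noteq> h A"
    then show False using line AC AD BC(2) CD pa by auto
  qed
qed

text \<open>Relative to \<open>pa\<close> there are eight parity patterns of the ports. All equal
  means collinear vertices, one exception is a diagonal fan, and in a split into two pairs each pair
  spans a diagonal of the square. Diagonals cross, which \<open>disj\<close> forbids for all splits
  but AC and BD. In the conclusion \<open>\<i> * pa\<close> points from \<open>A\<close> to the
  centre and \<open>r\<close> is the radius.\<close>

lemma K4_circle:
  assumes ports: "pa \<in> ports" "pb \<in> ports" "pc \<in> ports" "pd \<in> ports"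
    and j: "joins (- pa) pb A B XAB" "joins (\<i> * pa) (\<i> * pc) A C XAC" "joins pa (- pd) A D XAD"
      "joins (- pb) pc B C XBC" "joins (\<i> * pb) (\<i> * pd) B D XBD" "joins (- pc) pd C D XCD"
    and ne: "A \<noteq> B" "A \<noteq> C" "A \<noteq> D" "B \<noteq> C" "B \<noteq> D" "C \<noteq> D"
    and avoid: "C \<notin> XAB" "D \<notin> XAB" "B \<notin> XAC" "D \<notin> XAC" "B \<notin> XAD" "C \<notin> XAD"
      "A \<notin> XBC" "D \<notin> XBC" "A \<notin> XBD" "C \<notin> XBD" "A \<notin> XCD" "B \<notin> XCD"
    and disj: "XAB \<inter> XCD = {}" "XAD \<inter> XBC = {}"
  shows "pb = - \<i> * pa \<and> (\<exists>r>0. B = A + of_real r * (1 + \<i>) * (\<i> * pa))"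
proof -
  have p: "- x \<in> ports" "\<i> * x \<in> ports" "- x \<in> \<real> \<longleftrightarrow> x \<in> \<real>" "\<i> * x \<in> \<real> \<longleftrightarrow> x \<notin> \<real>" if "x \<in> ports" for x
    using that by (auto simp: ports_def complex_is_Real_iff)
  note pp = p[OF ports(1)] p[OF ports(2)] p[OF ports(3)] p[OF ports(4)]
  have
    AB: "if pa \<in> \<real> \<longleftrightarrow> pb \<in> \<real> then axis_aligned A B else diagonal A B" and
    AC: "if pa \<in> \<real> \<longleftrightarrow> pc \<in> \<real> then axis_aligned A C else diagonal A C" and
    AD: "if pa \<in> \<real> \<longleftrightarrow> pd \<in> \<real> then axis_aligned A D else diagonal A D" and
    BC: "if pb \<in> \<real> \<longleftrightarrow> pc \<in> \<real> then axis_aligned B C else diagonal B C" and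
    BD: "if pb \<in> \<real> \<longleftrightarrow> pd \<in> \<real> then axis_aligned B D else diagonal B D" and
    CD: "if pc \<in> \<real> \<longleftrightarrow> pd \<in> \<real> then axis_aligned C D else diagonal C D"
    using j[THEN joins_parity] by (simp_all add: ports pp cong: if_cong)
  note edges = AB AC AD BC BD CD
  consider (all) "pa \<in> \<real> \<longleftrightarrow> pb \<in> \<real>" "pa \<in> \<real> \<longleftrightarrow> pc \<in> \<real>" "pa \<in> \<real> \<longleftrightarrow> pd \<in> \<real>"
    | (fan_a) "pb \<in> \<real> \<longleftrightarrow> pa \<notin> \<real>" "pc \<in> \<real> \<longleftrightarrow> pa \<notin> \<real>" "pd \<in> \<real> \<longleftrightarrow> pa \<notin> \<real>"
    | (fan_b) "pb \<in> \<real> \<longleftrightarrow> pa \<notin> \<real>" "pa \<in> \<real> \<longleftrightarrow> pc \<in> \<real>" "pa \<in> \<real> \<longleftrightarrow> pd \<in> \<real>"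
    | (fan_c) "pa \<in> \<real> \<longleftrightarrow> pb \<in> \<real>" "pc \<in> \<real> \<longleftrightarrow> pa \<notin> \<real>" "pa \<in> \<real> \<longleftrightarrow> pd \<in> \<real>"
    | (fan_d) "pa \<in> \<real> \<longleftrightarrow> pb \<in> \<real>" "pa \<in> \<real> \<longleftrightarrow> pc \<in> \<real>" "pd \<in> \<real> \<longleftrightarrow> pa \<notin> \<real>"
    | (ab) "pa \<in> \<real> \<longleftrightarrow> pb \<in> \<real>" "pc \<in> \<real> \<longleftrightarrow> pa \<notin> \<real>" "pd \<in> \<real> \<longleftrightarrow> pa \<notin> \<real>"
    | (ac) "pb \<in> \<real> \<longleftrightarrow> pa \<notin> \<real>" "pa \<in> \<real> \<longleftrightarrow> pc \<in> \<real>" "pd \<in> \<real> \<longleftrightarrow> pa \<notin> \<real>"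
    | (ad) "pb \<in> \<real> \<longleftrightarrow> pa \<notin> \<real>" "pc \<in> \<real> \<longleftrightarrow> pa \<notin> \<real>" "pa \<in> \<real> \<longleftrightarrow> pd \<in> \<real>"
    by blast
  then show ?thesis
  proof cases
    case all
    have "x = pa \<or> x = - pa" if "x \<in> ports" "pa \<in> \<real> \<longleftrightarrow> x \<in> \<real>" for x
      using that ports(1) by (auto simp: ports_def complex_is_Real_iff)
    then show ?thesis using K4_not_collinear[OF ports(1) _ _ _ j _ _ _ _ _ _ ne] edges all ports by simp
  next
    case fan_a
    then show ?thesis using no_diagonal_fan[of B C D A] edges ne by (simp add: diagonal_commute)
  next
    case fan_b
    then show ?thesis using no_diagonal_fan[of A C D B] edges ne by (simp add: diagonal_commute)
  next
    case fan_c
    then show ?thesis using no_diagonal_fan[of A B D C] edges ne by (simp add: diagonal_commute)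
  next
    case fan_d
    then show ?thesis using no_diagonal_fan[of A B C D] edges ne by (simp add: diagonal_commute)
  next
    case ab
    have "XAB \<inter> XCD \<noteq> {}"
      by (rule crossing_diagonals(1)[OF _ _ _ _ j(1,6)])
        (use ports pp ab edges ne avoid in \<open>simp_all add: diagonal_commute\<close>)
    then show ?thesis using disj by simp
  next
    case ad
    have "XAD \<inter> XBC \<noteq> {}"
      by (rule crossing_diagonals(1)[OF _ _ _ _ j(3,4)])
        (use ports pp ad edges ne avoid in \<open>simp_all add: diagonal_commute\<close>)
    then show ?thesis using disj by simp
  next
    case ac
    note cross = crossing_diagonals[OF pp(2) pp(10) pp(6) pp(14) j(2,5)]
    have sum: "A + C = B + D"
      and C: "\<exists>r>0. C = A + of_real r * (\<i> * pa)" and D: "\<exists>r>0. D = B + of_real r * (\<i> * pb)"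
      by (rule cross(4-6); use ports pp ac edges ne avoid in \<open>simp add: diagonal_commute\<close>)+
    have dg: "diagonal A B" "diagonal C B" using edges ac by (simp_all add: diagonal_commute)
    obtain r where r: "r > 0" "C = A + of_real r * (\<i> * pa)" using C by auto
    obtain r' where r': "r' > 0" "D = B + of_real r' * (\<i> * pb)" using D by auto
    have B: "2 * B = 2 * A + of_real r * (\<i> * pa) - of_real r' * (\<i> * pb)"
      using sum r r' by (simp add: algebra_simps)
    have pb: "pb = \<i> * pa \<or> pb = - \<i> * pa"
      using ports(1,2) ac by (auto simp: ports_def complex_is_Real_iff)
    \<comment> \<open>Slope 1 or -1 of the side AB makes the two perpendicular diameters equally
      long.\<close>
    have "r = r'"
      using pb dg(1) B r(1) r'(1) ports(1)
      by (auto simp: diagonal_def ports_def complex_eq_iff abs_if split: if_splits)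
    have B': "2 * (B - A) = of_real r * \<i> * (pa - pb)" using B \<open>r = r'\<close> by (simp add: algebra_simps)
    show ?thesis
    proof (cases "pb = - \<i> * pa")
      case True
      have half: "x = y / 2" if "2 * x = y" for x y :: complex using that[symmetric] by simp
      have "2 * (B - A) = of_real r * (1 + \<i>) * (\<i> * pa)"
        using B' True by (simp add: algebra_simps)
      from half[OF this] have "B - A = of_real (r / 2) * (1 + \<i>) * (\<i> * pa)"
        by (simp only: of_real_divide of_real_numeral times_divide_eq_left)
      then have "B = A + of_real (r / 2) * (1 + \<i>) * (\<i> * pa)"
        by (simp only: diff_eq_eq add.commute)
      then show ?thesis using True r(1) half_gt_zero by blast
    next
      \<comment> \<open>The mirror image: going from \<open>A\<close> to \<open>B\<close> turns
        counterclockwise about the centre. The ports of AB are perpendicular, and a quarter arc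
        would lead in the opposite direction.\<close>
      case False
      then have pb: "pb = \<i> * pa" using pb by blast
      have pa0: "pa \<noteq> 0" using ports(1) by (auto simp: ports_def)
      have w: "(1 + \<i>) * pa \<noteq> 0" using pa0 by (simp add: complex_eq_iff[of "1 + \<i>"])
      have B2: "2 * (B - A) = of_real r * (1 + \<i>) * pa" using B' unfolding pb by (simp add: algebra_simps)
      from j(1) have False
      proof cases
        case (line t)
        then show False using pb pa0 by (simp add: complex_eq_iff[of \<i>])
      next
        case (quarter t s)
        have "s = \<i>" using quarter(2,3) pb pa0 by auto
        have "of_real r * ((1 + \<i>) * pa) = 2 * (B - A)" using B2 by (simp only: mult.assoc)
        also have "B - A = of_real t * - pa * (1 + \<i>)" using quarter(4) \<open>s = \<i>\<close> by simp
        also have "2 * \<dots> = of_real (- 2 * t) * ((1 + \<i>) * pa)" by (simp add: algebra_simps)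
        finally have "r = - 2 * t" by (simp only: mult_right_cancel[OF w] of_real_eq_iff)
        then show False using r(1) quarter(1) by simp
      next
        case (semicircle t s)
        have "(1 + \<i>) * pa = pa + pb" unfolding pb by (simp add: algebra_simps)
        then show False using w semicircle(3) by simp
      next
        case (three_quarter t s)
        have s: "s = - \<i>" using three_quarter(2,3) pb pa0 by auto
        have "of_real r * ((1 + \<i>) * pa) = 2 * (B - A)" using B2 by (simp only: mult.assoc)
        also have "B - A = of_real t * - pa * (- \<i> - 1)" using three_quarter(4) s by simp
        also have "2 * \<dots> = of_real (2 * t) * ((1 + \<i>) * pa)" by (simp add: algebra_simps)
        finally have "r = 2 * t" by (simp only: mult_right_cancel[OF w] of_real_eq_iff)
        \<comment> \<open>A three-quarter arc leads to the right point \<open>B\<close>, but runs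
          along the circle through all four vertices the long way round and contains the point
          opposite \<open>A\<close>.\<close>
        then have "C \<in> XAB" using three_quarter(5) r(2) s by (simp add: mult_ac)
        then show False using avoid by simp
      qed
      then show ?thesis ..
    qed
  qed
qed

section \<open>Links between two circles\<close>

text \<open>The sign of \<open>t\<close> tells a quarter arc from a three-quarter arc, so a single
  linear equation treats both.\<close>

lemma joins_oblique:
  assumes "joins d e p q X" "d \<in> ports" "s \<in> {\<i>, - \<i>}" "e = s * d"
  obtains t where "q = p + of_real t * (1 - s) * d"
  using assms(1)
proof cases
  case (line r)
  then show thesis using assms by (auto simp: ports_def complex_eq_iff)
next
  case (quarter r s')
  then have "s' = - s" using assms by (auto simp: ports_def)
  then show thesis using quarter(4) that[of r] by (simp add: mult_ac)
next
  case (semicircle r s')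
  then show thesis using assms by (auto simp: ports_def complex_eq_iff)
next
  case (three_quarter r s')
  then have "s' = s" using assms by (auto simp: ports_def)
  then show thesis using three_quarter(4) that[of "- r"] by (simp add: algebra_simps)
qed

lemma joins_opposite:
  assumes "joins d (- d) p q X" "d \<in> ports"
  obtains r where "0 < r" "q = p + of_real r * d"
  using assms(1)
proof cases
  case (line r)
  then show thesis using that by simp
qed (use assms in \<open>auto simp: ports_def complex_eq_iff\<close>)

text \<open>Only a semicircle returns to the port direction it started with. The half-strip that
  contains it is enough to keep two links apart.\<close>

lemma joins_same_port:
  assumes "joins d d p q X" "d \<in> ports"
  obtains r s where "0 < r" "s \<in> {1, -1 :: real}" "q = p + of_real (2 * r * s) * \<i> * d"
    "\<And>z. z \<in> X \<Longrightarrow> \<exists>x y. 0 \<le> x \<and> 0 \<le> y \<and> y \<le> 2 * r \<and> z = p + d * (of_real x + of_real (y * s) * \<i>)"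
  using assms(1)
proof cases
  case (semicircle r s)
  define \<sigma> where "\<sigma> = Im s"
  have \<sigma>: "\<sigma> \<in> {1, -1}" "s = of_real \<sigma> * \<i>" using semicircle(2) by (auto simp: \<sigma>_def)
  show thesis
  proof (rule that[OF semicircle(1) \<sigma>(1)])
    show "q = p + of_real (2 * r * \<sigma>) * \<i> * d" using semicircle(4) \<sigma>(2) by simp
    fix z assume "z \<in> X"
    from semicircle(6)[OF this]
    show "\<exists>x y. 0 \<le> x \<and> 0 \<le> y \<and> y \<le> 2 * r \<and> z = p + d * (of_real x + of_real (y * \<sigma>) * \<i>)"
      unfolding \<sigma>(2) by (simp only: of_real_mult mult.assoc)
  qed
qed (use assms in \<open>auto simp: ports_def complex_eq_iff\<close>)

text \<open>\<open>A\<close> and \<open>B\<close> are neighbours on one circle, \<open>A'\<close> and \<open>B'\<close> on another one; \<open>u\<close> and \<open>u'\<close>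
  point from \<open>A\<close> and \<open>A'\<close> to the centres.\<close>

lemma no_crossed_link:
  assumes u: "u \<in> ports" "u' \<in> ports" and r: "0 < r" "0 < r'"
    and B: "B = A + of_real r * (1 + \<i>) * u" "B' = A' + of_real r' * (1 + \<i>) * u'"
    and j: "joins (- u) (- u') A A' X" "joins (\<i> * u) (\<i> * u') B B' Y"
    and ne: "A \<noteq> B'" "B \<noteq> A'" and cross: "X \<inter> Y \<noteq> {}"
  shows False
proof -
  have u0: "u \<noteq> 0" using u by (auto simp: ports_def)
  have p: "- u \<in> ports" "\<i> * u \<in> ports" using u by (auto simp: ports_def)
  have ii: "\<i> * \<i> = -1" by simp
  have cancel: "f = g" if "f * u = g * u" for f g using that u0 by simp
  consider "u' = u" | "u' = - u" | "u' = \<i> * u" | "u' = - \<i> * u"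
    using u by (auto simp: ports_def)
  then show False
  proof cases
    case 1
    from joins_same_port[OF j(1)[unfolded 1] p(1)] obtain t s where t: "0 < t" "s \<in> {1, -1 :: real}"
      and A': "A' = A + of_real (2 * t * s) * \<i> * - u"
      and X: "\<And>z. z \<in> X \<Longrightarrow> \<exists>x y. 0 \<le> x \<and> 0 \<le> y \<and> y \<le> 2 * t \<and> z = A + - u * (of_real x + of_real (y * s) * \<i>)"
      by blast
    from joins_same_port[OF j(2)[unfolded 1] p(2)] obtain t' s' where t': "0 < t'" "s' \<in> {1, -1 :: real}"
      and B': "B' = B + of_real (2 * t' * s') * \<i> * (\<i> * u)"
      and Y: "\<And>z. z \<in> Y \<Longrightarrow> \<exists>x y. 0 \<le> x \<and> 0 \<le> y \<and> y \<le> 2 * t' \<and> z = B + \<i> * u * (of_real x + of_real (y * s') * \<i>)"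
      by blast
    \<comment> \<open>Both sides are B' - A divided into two steps, through \<open>B\<close> on the
      left and through A' on the right. The closed quadrilateral A, B, B', A' is the source of the
      equation in every case.\<close>
    have "(of_real r * (1 + \<i>) - of_real (2 * t' * s')) * u = (of_real r' * (1 + \<i>) - of_real (2 * t * s) * \<i>) * u"
      using A' B' B 1 ii by algebra
    from cancel[OF this] have ts: "r = r' - 2 * t * s" by (simp add: complex_eq_iff)
    obtain z where "z \<in> X" "z \<in> Y" using cross by auto
    with X Y obtain x y x' y' where xy: "0 \<le> y" "y \<le> 2 * t" "0 \<le> x'"
      "z = A + - u * (of_real x + of_real (y * s) * \<i>)" "z = B + \<i> * u * (of_real x' + of_real (y' * s') * \<i>)"
      by meson
    have "(- of_real x - of_real (y * s) * \<i>) * u = (of_real r * (1 + \<i>) + of_real x' * \<i> - of_real (y' * s')) * u"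
      using xy(4,5) B ii by algebra
    \<comment> \<open>Measure heights along \<open>\<i> * u\<close> from \<open>A\<close>.
      \<open>X\<close> stays between the heights 0 of \<open>A\<close> and r - r' of A', both below
      \<open>r\<close>, whereas \<open>Y\<close> starts at height \<open>r\<close> and extends
      upwards.\<close>
    from cancel[OF this] have "- (y * s) = r + x'" by (simp add: complex_eq_iff)
    then show False using ts t(2) xy(1-3) r by auto
  next
    case 2
    obtain t where t: "0 < t" "A' = A + of_real t * - u"
      by (rule joins_opposite[OF j(1)[unfolded 2] p(1)])
    obtain t' where t': "0 < t'" "B' = B + of_real t' * (\<i> * u)"
      by (rule joins_opposite[OF j(2)[unfolded 2 mult_minus_right] p(2)])
    have "(of_real r * (1 + \<i>) + of_real t' * \<i>) * u = (- of_real t - of_real r' * (1 + \<i>)) * u"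
      using t(2) t'(2) B 2 ii by algebra
    from cancel[OF this] show False using r t(1) by (simp add: complex_eq_iff)
  next
    case 3
    obtain t where t: "A' = A + of_real t * (1 - \<i>) * - u"
      by (rule joins_oblique[OF j(1) p(1), of \<i>]) (auto simp: 3)
    obtain t' where t': "B' = B + of_real t' * (1 - \<i>) * (\<i> * u)"
      by (rule joins_oblique[OF j(2) p(2), of \<i>]) (auto simp: 3)
    have "((of_real r + of_real t') * (1 + \<i>)) * u = ((- of_real t - of_real r') * (1 - \<i>)) * u"
      using t t' B 3 ii by algebra
    \<comment> \<open>1 + i and 1 - i are independent over the reals, so both coefficients
      vanish.\<close>
    from cancel[OF this] have "r' = - t" by (simp add: complex_eq_iff)
    then have "complex_of_real r' = - of_real t" by simp
    then have "B' = A" using t B(2) 3 ii by algebra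
    then show False using ne by simp
  next
    case 4
    obtain t where t: "A' = A + of_real t * (1 - - \<i>) * - u"
      by (rule joins_oblique[OF j(1) p(1), of "- \<i>"]) (auto simp: 4)
    obtain t' where t': "B' = B + of_real t' * (1 - - \<i>) * (\<i> * u)"
      by (rule joins_oblique[OF j(2) p(2), of "- \<i>"]) (auto simp: 4)
    have "((of_real r + of_real t) * (1 + \<i>)) * u = ((of_real r' + of_real t') * (1 - \<i>)) * u"
      using t t' B 4 ii by algebra
    from cancel[OF this] have "r = - t" by (simp add: complex_eq_iff)
    then have "complex_of_real r = - of_real t" by simp
    then have "A' = B" using t B(1) ii by algebra
    then show False using ne by simp
  qed
qed

section \<open>Straight-line drawings on a parabola\<close>

text \<open>Both angles lie strictly between 0 and pi, so their difference does not wrap around and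
  its sign is that of the imaginary part of the quotient.\<close>

lemma Arg2pi_less_iff:
  assumes "0 < Im z" "0 < Im w"
  shows "Arg2pi z < Arg2pi w \<longleftrightarrow> 0 < Im (w / z)"
proof
  assume "Arg2pi z < Arg2pi w"
  moreover have "Arg2pi (w / z) = Arg2pi w - Arg2pi z"
    using calculation assms by (intro Arg2pi_divide) auto
  moreover have "0 < Arg2pi z" "Arg2pi w < pi" using assms Arg2pi_lt_pi by blast+
  ultimately show "0 < Im (w / z)" using Arg2pi_lt_pi[of "w / z"] by simp
next
  assume pos: "0 < Im (w / z)"
  show "Arg2pi z < Arg2pi w"
  proof (rule ccontr)
    assume "\<not> Arg2pi z < Arg2pi w"
    then have "Arg2pi (z / w) = Arg2pi z - Arg2pi w"
      using assms by (intro Arg2pi_divide) auto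
    moreover have "0 < Arg2pi w" "Arg2pi z < pi" using assms Arg2pi_lt_pi by blast+
    ultimately have "Arg2pi (z / w) \<le> pi" by linarith
    then have "0 \<le> Im (z / w)" using Arg2pi_le_pi by blast
    then have "Im (inverse (z / w)) \<le> 0"
      unfolding inverse_complex.simps(2) by (intro divide_nonpos_nonneg) simp_all
    then show False using pos by simp
  qed
qed

definition cross_product :: "complex \<Rightarrow> complex \<Rightarrow> real" where
  "cross_product u v = Re u * Im v - Im u * Re v"

lemma Im_divide_pos_iff: "0 < Im (v / u) \<longleftrightarrow> 0 < cross_product u v"
proof (cases "u = 0")
  case False
  then have "0 < (Re u)\<^sup>2 + (Im u)\<^sup>2" by (simp add: complex_neq_0)
  then show ?thesis by (simp add: Im_divide cross_product_def zero_less_divide_iff mult.commute)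
qed (simp add: cross_product_def)

lemma ccw_dirs_half_plane:
  assumes "0 < cross_product u v" "0 < cross_product u w" "0 < cross_product v w"
  shows "ccw_dirs u v w"
proof -
  have "u \<noteq> 0" "v \<noteq> 0" using assms by (auto simp: cross_product_def)
  moreover have "0 < Im (v / u)" "0 < Im (w / u)" "0 < Im (w / v)"
    using assms by (simp_all add: Im_divide_pos_iff)
  ultimately show ?thesis
    using Arg2pi_less_iff[of "v / u" "w / u"] Arg2pi_lt_pi[of "v / u"] by (simp add: ccw_dirs_def)
qed

text \<open>These are the two cyclic orders that \<open>cross_at\<close> demands of the four rays at
  a crossing of straight lines.\<close>

lemma ccw_dirs_opposite:
  assumes "0 < cross_product u v"
  shows "ccw_dirs u v (- u)" "ccw_dirs (- u) (- v) u"
proof -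
  have u: "u \<noteq> 0" using assms by (auto simp: cross_product_def)
  have "0 < Arg2pi (v / u)" "Arg2pi (v / u) < pi"
    using assms Arg2pi_lt_pi[of "v / u"] by (simp_all add: Im_divide_pos_iff)
  moreover have "Arg2pi (- 1) = pi" by (rule Arg2pi_unique[of 1]) simp_all
  ultimately show "ccw_dirs u v (- u)" "ccw_dirs (- u) (- v) u"
    using u by (simp_all add: ccw_dirs_def)
qed

lemma ccw_dirs_distinct:
  assumes "ccw_dirs u v w" "u \<noteq> 0"
  shows "u \<noteq> v" "v \<noteq> w" "u \<noteq> w"
proof -
  have "Arg2pi 1 = 0" using Arg2pi_of_real[of 1] by simp
  then show "u \<noteq> v" "v \<noteq> w" "u \<noteq> w" using assms by (auto simp: ccw_dirs_def)
qed

lemma ccw_curves_linepaths: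
  assumes "ccw_dirs (b - a) (c - a) (d - a)" "b \<noteq> a" "c \<noteq> a" "d \<noteq> a"
  shows "ccw_curves (linepath a b) (linepath a c) (linepath a d)"
proof -
  let ?u = "sgn (b - a)" and ?v = "sgn (c - a)" and ?w = "sgn (d - a)"
  have dirs: "ccw_dirs ?u ?v ?w" using assms by (simp add: ccw_dirs_sgn)
  have "?u \<noteq> 0" using assms(2) by (simp add: sgn_zero_iff)
  note ccw_dirs_distinct[OF dirs this]
  moreover have "norm ?u = 1" "norm ?v = 1" "norm ?w = 1" using assms by (simp_all add: norm_sgn)
  moreover have "leaves (linepath a b) ?u" "leaves (linepath a c) ?v" "leaves (linepath a d) ?w"
    using assms by (simp_all add: leaves_linepath)
  ultimately show ?thesis using ccw_curves_iff dirs by metis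
qed

lemma subpath_linepath: "subpath s t (linepath a b) = linepath (linepath a b s) (linepath a b t)"
  by (rule ext) (simp add: subpath_def linepath_def algebra_simps)

lemma cross_at_linepaths:
  assumes p: "p \<in> closed_segment a b" "p \<in> closed_segment c d" "p \<notin> {a, b, c, d}"
    and "cross_product (b - a) (d - c) \<noteq> 0"
  shows "cross_at (linepath a b) (linepath c d) p"
proof -
  obtain s where s: "0 \<le> s" "s \<le> 1" "linepath a b s = p"
    using p(1) by (metis atLeastAtMost_iff imageE linepath_image_01)
  obtain t where t: "0 \<le> t" "t \<le> 1" "linepath c d t = p"
    using p(2) by (metis atLeastAtMost_iff imageE linepath_image_01)
  have st: "s \<in> {0<..<1}" "t \<in> {0<..<1}"
    using s t p(3) linepath_0'[of a b] linepath_1'[of a b] linepath_0'[of c d] linepath_1'[of c d]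
    by (auto simp: less_le)
  have st': "0 < s" "0 < 1 - s" "0 < t" "0 < 1 - t" using st by auto
  \<comment> \<open>The four rays at \<open>p\<close> are positive multiples of the directions of
    the two segments and their negatives, and positive factors do not affect
    \<open>ccw_dirs\<close>.\<close>
  have scaled1: "b - p = of_real (1 - s) * (b - a)" "a - p = of_real s * - (b - a)"
    unfolding s(3)[symmetric] by (simp_all add: linepath_def scaleR_conv_of_real algebra_simps)
  have scaled2: "d - p = of_real (1 - t) * (d - c)" "c - p = of_real t * - (d - c)"
    unfolding t(3)[symmetric] by (simp_all add: linepath_def scaleR_conv_of_real algebra_simps)
  note scaled = scaled1 scaled2
  have neg: "cross_product u (- v) = - cross_product u v" for u v
    by (simp add: cross_product_def)
  have ratio: "ccw_dirs (of_real x * u) (of_real y * v) (of_real z * w) \<longleftrightarrow> ccw_dirs u v w"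
    if "0 < x" "0 < y" "0 < z" for x y z u v w
  proof -
    have "Arg2pi (of_real r * q / (of_real x * u)) = Arg2pi (q / u)" if "0 < r" for r q
    proof -
      have "of_real r * q / (of_real x * u) = of_real (r / x) * (q / u)" by simp
      then show ?thesis using that \<open>0 < x\<close> by (simp only: Arg2pi_times_of_real divide_pos_pos)
    qed
    then show ?thesis using that by (simp add: ccw_dirs_def)
  qed
  have ne: "b \<noteq> p" "a \<noteq> p" "d \<noteq> p" "c \<noteq> p" using p(3) by auto
  have dirs: "ccw_dirs (b - p) (d - p) (a - p) \<and> ccw_dirs (a - p) (c - p) (b - p) \<or>
     ccw_dirs (b - p) (c - p) (a - p) \<and> ccw_dirs (a - p) (d - p) (b - p)"
  proof (cases "0 < cross_product (b - a) (d - c)")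
    case True
    then show ?thesis
      using ccw_dirs_opposite[of "b - a" "d - c"] st' unfolding scaled
      by (simp only: ratio simp_thms)
  next
    case False
    then have "0 < cross_product (b - a) (- (d - c))" using assms(4) by (simp add: neg del: minus_diff_eq)
    then show ?thesis
      using ccw_dirs_opposite[of "b - a" "- (d - c)"] st' unfolding scaled
      by (simp only: ratio minus_minus simp_thms)
  qed
  have "subpath s 1 (linepath a b) = linepath p b" "subpath s 0 (linepath a b) = linepath p a"
    "subpath t 1 (linepath c d) = linepath p d" "subpath t 0 (linepath c d) = linepath p c"
    using s t by (simp_all add: subpath_linepath linepath_0' linepath_1')
  then show ?thesis
    unfolding cross_at_def Let_def using dirs ne st s(3) t(3) ccw_curves_linepaths by metis
qed

text \<open>The vertices are placed in strictly convex position, so every set of chords gives a drawing.\<close>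

definition parabola :: "nat \<Rightarrow> complex" where
  "parabola k = Complex (real k) ((real k)\<^sup>2)"

definition parabola_drawing :: "nat drawing" where
  "parabola_drawing = \<lparr>pos = parabola, curve = \<lambda>u v. linepath (parabola u) (parabola v)\<rparr>"

lemma parabola_drawing_simps [simp]:
  "pos parabola_drawing = parabola"
  "curve parabola_drawing u v = linepath (parabola u) (parabola v)"
  by (simp_all add: parabola_drawing_def)

lemma parabola_eq_iff [simp]: "parabola u = parabola v \<longleftrightarrow> u = v"
  by (auto simp: parabola_def)

text \<open>The chord from \<open>u\<close> to \<open>v\<close> lies on the line \<open>y = (u + v) x - u v\<close>.\<close>

definition height_above :: "nat \<Rightarrow> nat \<Rightarrow> complex \<Rightarrow> real" where
  "height_above u v z = Im z - (real u + real v) * Re z + real u * real v"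

lemma height_above_parabola:
  "height_above u v (parabola w) = (real w - real u) * (real w - real v)"
  by (simp add: height_above_def parabola_def algebra_simps power2_eq_square)

lemma height_above_convex:
  "height_above u v ((1 - t) *\<^sub>R a + t *\<^sub>R b) = (1 - t) * height_above u v a + t * height_above u v b"
  by (simp add: height_above_def algebra_simps)

lemma chordE:
  assumes "z \<in> closed_segment (parabola u) (parabola v)"
  obtains t where "0 \<le> t" "t \<le> 1" "z = (1 - t) *\<^sub>R parabola u + t *\<^sub>R parabola v"
  using assms by (auto simp: closed_segment_def)

lemma height_above_chord:
  assumes "z \<in> closed_segment (parabola u) (parabola v)" shows "height_above u v z = 0"
  using assms by (elim chordE) (simp add: height_above_convex height_above_parabola)

lemma parabola_on_chord:
  "parabola w \<in> closed_segment (parabola u) (parabola v) \<longleftrightarrow> w = u \<or> w = v"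
  using height_above_chord[of "parabola w" u v] by (auto simp: height_above_parabola)

text \<open>The two chords have the distinct slopes u + v and u + w.\<close>

lemma chords_adjacent:
  assumes "v \<noteq> w"
  shows "closed_segment (parabola u) (parabola v) \<inter> closed_segment (parabola u) (parabola w) = {parabola u}"
proof -
  have "z = parabola u" if "z \<in> closed_segment (parabola u) (parabola v)"
    "z \<in> closed_segment (parabola u) (parabola w)" for z
  proof -
    have h: "height_above u v z = 0" "height_above u w z = 0" using that height_above_chord by blast+
    then have "(real v - real w) * (Re z - real u) = 0"
      by (simp add: height_above_def algebra_simps)
    then have "Re z = real u" using assms by simp
    then show ?thesis using h(1)
      by (simp add: height_above_def parabola_def complex_eq_iff algebra_simps power2_eq_square)
  qed
  then show ?thesis by auto
qed

text \<open>The heights of \<open>u\<close> and \<open>v\<close> above the chord from \<open>x\<close> to \<open>y\<close> have opposite signs.\<close>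

definition interleaved :: "nat \<Rightarrow> nat \<Rightarrow> nat \<Rightarrow> nat \<Rightarrow> bool" where
  "interleaved u v x y \<longleftrightarrow>
     (int u - int x) * (int u - int y) * ((int v - int x) * (int v - int y)) < 0"

text \<open>The heights of \<open>u\<close> and \<open>v\<close> above the chord from
  \<open>x\<close> to \<open>y\<close> have a weighted mean 0 at \<open>p\<close>, so their signs
  differ. Equal slopes would put both chords on one line, and \<open>u\<close> would have height
  0.\<close>

lemma chords_cross:
  assumes p: "p \<in> closed_segment (parabola u) (parabola v)" "p \<in> closed_segment (parabola x) (parabola y)"
    and disj: "{u, v} \<inter> {x, y} = {}"
  shows "interleaved u v x y" "real u + real v \<noteq> real x + real y"
proof -
  let ?h = "height_above x y"
  from p(1) obtain t where t: "0 \<le> t" "t \<le> 1" "p = (1 - t) *\<^sub>R parabola u + t *\<^sub>R parabola v"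
    by (rule chordE)
  have h: "(1 - t) * ?h (parabola u) + t * ?h (parabola v) = 0"
    using height_above_chord[OF p(2)] unfolding t(3) height_above_convex .
  have nz: "?h (parabola u) \<noteq> 0" "?h (parabola v) \<noteq> 0"
    using disj by (auto simp: height_above_parabola)
  have t01: "0 < t" "t < 1" using h nz t by (auto simp: less_le)
  have "?h (parabola u) * ?h (parabola v) < 0"
  proof (rule ccontr)
    assume "\<not> ?h (parabola u) * ?h (parabola v) < 0"
    then have "0 < ?h (parabola u) * ?h (parabola v)" using nz by (simp add: less_le)
    then consider "0 < ?h (parabola u)" "0 < ?h (parabola v)" | "?h (parabola u) < 0" "?h (parabola v) < 0"
      by (auto simp: zero_less_mult_iff)
    then show False
    proof cases
      case 1
      then have "0 < (1 - t) * ?h (parabola u)" "0 < t * ?h (parabola v)" using t01 by simp_all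
      then show False using h by simp
    next
      case 2
      then have "(1 - t) * ?h (parabola u) < 0" "t * ?h (parabola v) < 0"
        using t01 by (simp_all add: mult_pos_neg)
      then show False using h by simp
    qed
  qed
  then have "real_of_int ((int u - int x) * (int u - int y) * ((int v - int x) * (int v - int y))) < 0"
    by (simp add: height_above_parabola)
  then show "interleaved u v x y" unfolding interleaved_def by (simp only: of_int_less_0_iff)
  show "real u + real v \<noteq> real x + real y"
  proof
    assume eq: "real u + real v = real x + real y"
    have "height_above u v p = 0" "height_above x y p = 0" using p height_above_chord by blast+
    then have prod: "real u * real v = real x * real y" using eq by (simp add: height_above_def)
    have "height_above x y (parabola u) = height_above u v (parabola u)"
      unfolding height_above_def eq prod ..
    then show False using nz by (simp add: height_above_parabola)
  qed
qed

lemma chords_cross_unique: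
  assumes "p \<in> closed_segment (parabola u) (parabola v)" "p \<in> closed_segment (parabola x) (parabola y)"
    "q \<in> closed_segment (parabola u) (parabola v)" "q \<in> closed_segment (parabola x) (parabola y)"
    and disj: "{u, v} \<inter> {x, y} = {}"
  shows "p = q"
proof -
  have h: "height_above u v p = 0" "height_above x y p = 0" "height_above u v q = 0" "height_above x y q = 0"
    using assms height_above_chord by blast+
  have "(real u + real v - (real x + real y)) * (Re p - Re q) = 0"
    using h by (simp add: height_above_def algebra_simps)
  then have "Re p = Re q" using chords_cross(2)[OF assms(1,2) disj] by simp
  then show ?thesis using h by (simp add: height_above_def complex_eq_iff)
qed

section \<open>Graphs drawn with chords\<close>

lemma is_drawing_parabola:
  assumes "simple_graph V E"
  shows "is_drawing V E parabola_drawing"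
proof -
  have ne: "u \<noteq> v" if "{u, v} \<in> E" for u v
    using assms that unfolding simple_graph_def by fastforce
  have cross: "cross_at (linepath (parabola u) (parabola v)) (linepath (parabola x) (parabola y)) p"
    if "{u, v} \<inter> {x, y} = {}" "p \<in> closed_segment (parabola u) (parabola v)"
      "p \<in> closed_segment (parabola x) (parabola y)" "u \<noteq> v" "x \<noteq> y" for u v x y p
  proof (rule cross_at_linepaths[OF that(2,3)])
    show "p \<notin> {parabola u, parabola v, parabola x, parabola y}"
      using that by (auto simp: parabola_on_chord)
    \<comment> \<open>The two horizontal extents times the difference of the slopes.\<close>
    have "cross_product (parabola v - parabola u) (parabola y - parabola x) =
      (real v - real u) * (real y - real x) * (real x + real y - (real u + real v))"
      by (simp add: cross_product_def parabola_def power2_eq_square algebra_simps)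
    then show "cross_product (parabola v - parabola u) (parabola y - parabola x) \<noteq> 0"
      using that chords_cross(2)[OF that(2,3,1)] by simp
  qed
  show ?thesis
    unfolding is_drawing_def parabola_drawing_simps path_image_linepath
  proof (intro conjI allI impI ballI)
    show "inj_on parabola V" by (simp add: inj_on_def)
  next
    fix u v x y p
    assume "{u, v} \<in> E" "{x, y} \<in> E" "{u, v} \<inter> {x, y} = {}"
      "p \<in> closed_segment (parabola u) (parabola v) \<inter> closed_segment (parabola x) (parabola y)"
    then show "cross_at (linepath (parabola u) (parabola v)) (linepath (parabola x) (parabola y)) p"
      using cross[of u v x y p] ne[of u v] ne[of x y] by simp
  qed (use ne in \<open>auto simp: parabola_on_chord chords_adjacent\<close>)
qed

lemma edge_image_eq:
  assumes "is_drawing V E D" "{u, v} \<in> E"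
  shows "edge_image D {u, v} = path_image (curve D u v)"
proof -
  have "curve D v u = reversepath (curve D u v)"
    using assms unfolding is_drawing_def by blast
  then have "path_image (curve D v u) = path_image (curve D u v)" by simp
  then show ?thesis by (auto simp: edge_image_def doubleton_eq_iff)
qed

lemma edge_image_parabola: "edge_image parabola_drawing {u, v} = closed_segment (parabola u) (parabola v)"
  by (auto simp: edge_image_def doubleton_eq_iff closed_segment_commute)

lemma crossings_parabolaE:
  assumes "simple_graph V E" "(e, f, p) \<in> crossings E parabola_drawing"
  obtains u v x y where "e = {u, v}" "f = {x, y}" "e \<in> E" "f \<in> E" "{u, v} \<inter> {x, y} = {}"
    "p \<in> closed_segment (parabola u) (parabola v)" "p \<in> closed_segment (parabola x) (parabola y)"
    "interleaved u v x y"
proof -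
  have *: "e \<in> E" "f \<in> E" "e \<inter> f = {}" "p \<in> edge_image parabola_drawing e" "p \<in> edge_image parabola_drawing f"
    using assms(2) by (auto simp: crossings_def)
  have "card e = 2" "card f = 2" using assms(1) * by (auto simp: simple_graph_def)
  then obtain u v x y where "e = {u, v}" "f = {x, y}" by (meson card_2_iff)
  then show thesis using that * chords_cross(1) by (metis edge_image_parabola)
qed

text \<open>Crossing chords are interleaved and meet only once, so 1-planarity reduces to a
  condition on the endpoints. Convex position puts every vertex on the outer face.\<close>

lemma outer_one_plane_parabola:
  assumes G: "simple_graph V E"
    and one: "\<And>u v x y x' y'. {u, v} \<in> E \<Longrightarrow> {x, y} \<in> E \<Longrightarrow> {x', y'} \<in> E \<Longrightarrow>
      interleaved u v x y \<Longrightarrow> interleaved u v x' y' \<Longrightarrow> {x, y} = {x', y'}"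
  shows "outer_one_plane_graph V E parabola_drawing"
proof -
  have inter: "interleaved u v x y \<longleftrightarrow> interleaved v u x y" for u v x y
    by (simp add: interleaved_def mult.commute)
  have "f = f' \<and> p = p'"
    if c: "(e, f, p) \<in> crossings E parabola_drawing" "(e, f', p') \<in> crossings E parabola_drawing" for e f f' p p'
  proof -
    from crossings_parabolaE[OF G c(1)] obtain u v x y where 1: "e = {u, v}" "f = {x, y}" "e \<in> E" "f \<in> E"
      "{u, v} \<inter> {x, y} = {}" "p \<in> closed_segment (parabola u) (parabola v)"
      "p \<in> closed_segment (parabola x) (parabola y)" "interleaved u v x y" .
    from crossings_parabolaE[OF G c(2)] obtain u' v' x' y' where 2: "e = {u', v'}" "f' = {x', y'}" "f' \<in> E"
      "p' \<in> closed_segment (parabola u') (parabola v')"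
      "p' \<in> closed_segment (parabola x') (parabola y')" "interleaved u' v' x' y'" .
    have "u' = u \<and> v' = v \<or> u' = v \<and> v' = u" using 1(1) 2(1) by (auto simp: doubleton_eq_iff)
    then have 3: "interleaved u v x' y'" "p' \<in> closed_segment (parabola u) (parabola v)"
      using 2 inter by (auto simp: closed_segment_commute)
    then have ff: "f = f'" using one 1 2 by metis
    then have "closed_segment (parabola x') (parabola y') = closed_segment (parabola x) (parabola y)"
      using 1(2) 2(2) edge_image_parabola by metis
    with 2(5) have "p' \<in> closed_segment (parabola x) (parabola y)" by (simp only:)
    then have "p = p'" using chords_cross_unique[OF 1(6,7) 3(2) _ 1(5)] by blast
    then show ?thesis using ff by simp
  qed
  then have one_planar: "one_planar V E parabola_drawing"
    using is_drawing_parabola[OF G] unfolding one_planar_def by blast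
  have "parabola v \<in> frontier (outer_face V E parabola_drawing)" if "v \<in> V" for v
  proof -
    let ?K = "parabola ` V \<union> (\<Union>e\<in>E. edge_image parabola_drawing e)"
    \<comment> \<open>For equal endpoints the chord degenerates to the tangent at \<open>v\<close>.
      The whole drawing lies on or above it, and the open half-plane below belongs to the outer
      face.\<close>
    let ?H = "{z. height_above v v z \<ge> 0}"
    have convex: "convex ?H"
      unfolding convex_alt by (auto simp: height_above_convex)
    have par: "parabola w \<in> ?H" for w by (simp add: height_above_parabola)
    have chord: "edge_image parabola_drawing {x, y} \<subseteq> ?H" for x y
      unfolding edge_image_parabola by (rule closed_segment_subset[OF par par convex])
    have "?K \<subseteq> ?H"
    proof (intro Un_least UN_least image_subsetI par)
      fix e assume "e \<in> E"
      then obtain x y where "e = {x, y}" using G unfolding simple_graph_def by (metis card_2_iff)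
      then show "edge_image parabola_drawing e \<subseteq> ?H" using chord by simp
    qed
    then have out: "- ?H \<subseteq> outer_face V E parabola_drawing"
      unfolding outer_face_def parabola_drawing_simps by (rule outside_subset_convex[OF convex])
    have "parabola v \<notin> outer_face V E parabola_drawing"
      using that outside_no_overlap[of ?K] unfolding outer_face_def parabola_drawing_simps by blast
    moreover have "parabola v \<in> closure (outer_face V E parabola_drawing)"
    proof -
      have "((\<lambda>t. parabola v - of_real t * \<i>) \<longlongrightarrow> parabola v - of_real 0 * \<i>) (at_right 0)"
        by (intro tendsto_intros)
      then have "((\<lambda>t. parabola v - of_real t * \<i>) \<longlongrightarrow> parabola v) (at_right 0)" by simp
      moreover have "\<forall>\<^sub>F t in at_right 0. parabola v - of_real t * \<i> \<in> closure (outer_face V E parabola_drawing)"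
      proof -
        have "\<forall>\<^sub>F t in at_right 0. (0::real) < t" by (simp add: eventually_at_right_less)
        then show ?thesis
        proof eventually_elim
          case (elim t)
          have "height_above v v (parabola v - of_real t * \<i>) = - t"
            by (simp add: height_above_def parabola_def power2_eq_square algebra_simps)
          then have "parabola v - of_real t * \<i> \<in> - ?H" using elim by simp
          then show ?case using out closure_subset by blast
        qed
      qed
      ultimately show ?thesis
        by (intro Lim_in_closed_set[of "closure (outer_face V E parabola_drawing)" _ "at_right (0::real)"])
          (auto simp: trivial_limit_at_right_real)
    qed
    ultimately show ?thesis using interior_subset unfolding frontier_def by blast
  qed
  then show ?thesis
    using G one_planar unfolding outer_one_plane_graph_def outer_one_planar_def by simp
qed

text \<open>Each hypothesis is the cross product of two chord vectors at \<open>v\<close>, so for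
  concrete vertices the order is settled by integer arithmetic.\<close>

lemma ccw_curves_parabola:
  assumes "0 < (int x - int v) * (int y - int v) * (int y - int x)"
    "0 < (int x - int v) * (int z - int v) * (int z - int x)"
    "0 < (int y - int v) * (int z - int v) * (int z - int y)"
  shows "ccw_curves (curve parabola_drawing v x) (curve parabola_drawing v y) (curve parabola_drawing v z)"
proof -
  have cross: "cross_product (parabola b - parabola v) (parabola c - parabola v) =
    real_of_int ((int b - int v) * (int c - int v) * (int c - int b))" for b c
    by (simp add: cross_product_def parabola_def power2_eq_square algebra_simps)
  have "ccw_dirs (parabola x - parabola v) (parabola y - parabola v) (parabola z - parabola v)"
    by (rule ccw_dirs_half_plane; unfold cross of_int_0_less_iff; fact assms)
  moreover have "x \<noteq> v" "y \<noteq> v" "z \<noteq> v" using assms by auto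
  ultimately show ?thesis by (simp add: ccw_curves_linepaths)
qed

section \<open>Comparing embeddings\<close>

text \<open>The bijection of the crossing points preserves the set of edges through each of them;
  its surjectivity gives the converse direction.\<close>

lemma same_embedding_disjoint:
  assumes emb: "same_embedding V E D L" and ef: "e \<in> E" "f \<in> E" "e \<inter> f = {}"
  shows "edge_image L e \<inter> edge_image L f = {} \<longleftrightarrow> edge_image D e \<inter> edge_image D f = {}"
proof -
  obtain \<phi> where bij: "bij_betw \<phi> (crossing_points E D) (crossing_points E L)"
    and edges: "\<And>p. p \<in> crossing_points E D \<Longrightarrow>
      {e \<in> E. p \<in> edge_image D e} = {e \<in> E. \<phi> p \<in> edge_image L e}"
    using emb unfolding same_embedding_def by auto
  have cp: "p \<in> crossing_points E G" if "p \<in> edge_image G e" "p \<in> edge_image G f" for p and G :: "'a drawing"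
    using that ef unfolding crossing_points_def crossings_def by blast
  show ?thesis
  proof
    assume L: "edge_image L e \<inter> edge_image L f = {}"
    show "edge_image D e \<inter> edge_image D f = {}"
    proof (rule ccontr)
      assume "edge_image D e \<inter> edge_image D f \<noteq> {}"
      then obtain p where p: "p \<in> edge_image D e" "p \<in> edge_image D f" by auto
      from edges[OF cp[OF this]] have "\<phi> p \<in> edge_image L e" "\<phi> p \<in> edge_image L f" using p ef by blast+
      then show False using L by auto
    qed
  next
    assume D: "edge_image D e \<inter> edge_image D f = {}"
    show "edge_image L e \<inter> edge_image L f = {}"
    proof (rule ccontr)
      assume "edge_image L e \<inter> edge_image L f \<noteq> {}"
      then obtain q where q: "q \<in> edge_image L e" "q \<in> edge_image L f" by auto
      from cp[OF this] obtain p where "p \<in> crossing_points E D" "q = \<phi> p"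
        using bij by (metis bij_betw_imp_surj_on imageE)
      with edges q ef have "p \<in> edge_image D e" "p \<in> edge_image D f" by blast+
      then show False using D by auto
    qed
  qed
qed

text \<open>Three strictly increasing positive angles below 2 pi that are multiples of pi / 2 can
  only be pi / 2, pi and 3 pi / 2.\<close>

lemma ports_rotation:
  assumes ccw: "ccw_dirs p1 p2 p3" "ccw_dirs p1 p3 p4"
    and ports: "p1 \<in> ports" "p2 \<in> ports" "p3 \<in> ports" "p4 \<in> ports"
  shows "p2 = \<i> * p1" "p3 = - p1" "p4 = - \<i> * p1"
proof -
  have arg: "Arg2pi 1 = 0" "Arg2pi \<i> = pi / 2" "Arg2pi (- 1) = pi" "Arg2pi (- \<i>) = 3 * pi / 2"
  proof -
    show "Arg2pi 1 = 0" using Arg2pi_of_real[of 1] by simp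
    show "Arg2pi (- 1) = pi" by (rule Arg2pi_unique[of 1]) simp_all
    have cis: "cis (pi / 2) = \<i>" "cis (3 * pi / 2) = - \<i>"
      using cis_mult[of pi "pi / 2"] by simp_all
    show "Arg2pi \<i> = pi / 2"
      by (rule Arg2pi_unique[of 1]) (use cis in \<open>simp_all add: cis_conv_exp\<close>)
    show "Arg2pi (- \<i>) = 3 * pi / 2"
      by (rule Arg2pi_unique[of 1]) (use cis in \<open>simp_all add: cis_conv_exp\<close>)
  qed
  have p1: "p1 \<noteq> 0" using ports(1) by (auto simp: ports_def)
  have val: "p = p1 \<and> Arg2pi (p / p1) = 0 \<or> p = \<i> * p1 \<and> Arg2pi (p / p1) = pi / 2 \<or>
     p = - p1 \<and> Arg2pi (p / p1) = pi \<or> p = - \<i> * p1 \<and> Arg2pi (p / p1) = 3 * pi / 2" if "p \<in> ports" for p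
  proof -
    have "p = p1 \<or> p = \<i> * p1 \<or> p = - p1 \<or> p = - \<i> * p1" using that ports(1) by (auto simp: ports_def)
    then show ?thesis using p1 arg by auto
  qed
  have "0 < Arg2pi (p2 / p1)" "Arg2pi (p2 / p1) < Arg2pi (p3 / p1)" "Arg2pi (p3 / p1) < Arg2pi (p4 / p1)"
    using ccw by (simp_all add: ccw_dirs_def)
  then show "p2 = \<i> * p1" "p3 = - p1" "p4 = - \<i> * p1"
    using val[OF ports(2)] val[OF ports(3)] val[OF ports(4)] pi_gt_zero by linarith+
qed

text \<open>The vertices \<open>a\<close>, \<open>b\<close>, \<open>c\<close>, \<open>d\<close> span two crossing edges with all four sides, and each has
  one more edge.  The layout places them on a circle; \<open>u\<close> points from \<open>a\<close> to its centre.\<close>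

lemma block_is_circle:
  assumes draw: "is_drawing V E L" and emb: "same_embedding V E D L"
    and P: "\<And>v w. {v, w} \<in> E \<Longrightarrow> leaves (curve L v w) (P v w)"
      "\<And>v w. {v, w} \<in> E \<Longrightarrow> P v w \<in> ports"
      "\<And>v w w'. {v, w} \<in> E \<Longrightarrow> {v, w'} \<in> E \<Longrightarrow> w \<noteq> w' \<Longrightarrow> P v w \<noteq> P v w'"
      "\<And>v w. {v, w} \<in> E \<Longrightarrow> joins (P v w) (P w v) (pos L v) (pos L w) (path_image (curve L v w))"
    and E: "{a, b} \<in> E" "{a, c} \<in> E" "{a, d} \<in> E" "{b, c} \<in> E" "{b, d} \<in> E" "{c, d} \<in> E"
      "{a, a'} \<in> E" "{b, b'} \<in> E" "{c, x} \<in> E" "{d, x} \<in> E"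
    and V: "{a, b, c, d} \<subseteq> V" and distinct: "distinct [a, b, c, d, x]" "a' \<notin> {a, b, c, d}" "b' \<notin> {a, b, c, d}"
    and ccw: "ccw_curves (curve D a d) (curve D a c) (curve D a b)" "ccw_curves (curve D a d) (curve D a b) (curve D a a')"
      "ccw_curves (curve D b b') (curve D b a) (curve D b d)" "ccw_curves (curve D b b') (curve D b d) (curve D b c)"
      "ccw_curves (curve D c b) (curve D c a) (curve D c d)" "ccw_curves (curve D c b) (curve D c d) (curve D c x)"
      "ccw_curves (curve D d x) (curve D d c) (curve D d b)" "ccw_curves (curve D d x) (curve D d b) (curve D d a)"
    and disj: "edge_image D {a, b} \<inter> edge_image D {c, d} = {}" "edge_image D {a, d} \<inter> edge_image D {b, c} = {}"
  shows "\<exists>u\<in>ports. \<exists>r>0. P a a' = - u \<and> P b b' = \<i> * u \<and> pos L b = pos L a + of_real r * (1 + \<i>) * u"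
proof -
  have norm: "norm q = 1" if "q \<in> ports" for q using that by (auto simp: ports_def)
  have rot: "P v w2 = \<i> * P v w1" "P v w3 = - P v w1" "P v w4 = - \<i> * P v w1"
    if e: "{v, w1} \<in> E" "{v, w2} \<in> E" "{v, w3} \<in> E" "{v, w4} \<in> E" and d: "distinct [w1, w2, w3, w4]"
      and c: "ccw_curves (curve D v w1) (curve D v w2) (curve D v w3)" "ccw_curves (curve D v w1) (curve D v w3) (curve D v w4)"
    for v w1 w2 w3 w4
  proof -
    have dirs: "ccw_dirs (P v x) (P v y) (P v z)"
      if "{v, x} \<in> E" "{v, y} \<in> E" "{v, z} \<in> E" "distinct [x, y, z]"
        "ccw_curves (curve D v x) (curve D v y) (curve D v z)" for x y z
    proof -
      have "ccw_curves (curve L v x) (curve L v y) (curve L v z)"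
        using emb that unfolding same_embedding_def by blast
      then show ?thesis
        using ccw_curves_iff[OF P(1) P(1) P(1) norm norm norm] P(2,3) that by simp
    qed
    have "ccw_dirs (P v w1) (P v w2) (P v w3)" "ccw_dirs (P v w1) (P v w3) (P v w4)"
      using dirs[OF e(1,2,3) _ c(1)] dirs[OF e(1,3,4) _ c(2)] d by simp_all
    from ports_rotation[OF this P(2)[OF e(1)] P(2)[OF e(2)] P(2)[OF e(3)] P(2)[OF e(4)]]
    show "P v w2 = \<i> * P v w1" "P v w3 = - P v w1" "P v w4 = - \<i> * P v w1" .
  qed
  have comm: "{v, w} \<in> E \<Longrightarrow> {w, v} \<in> E" for v w by (simp add: insert_commute)
  note E' = E E[THEN comm]
  have "distinct [d, c, b, a']" "distinct [b', a, d, c]" "distinct [b, a, d, x]" "distinct [x, c, b, a]"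
    using distinct by auto
  then have ra: "P a c = \<i> * P a d" "P a b = - P a d" "P a a' = - \<i> * P a d"
    and rb: "P b a = \<i> * P b b'" "P b d = - P b b'" "P b c = - \<i> * P b b'"
    and rc: "P c a = \<i> * P c b" "P c d = - P c b"
    and rd: "P d c = \<i> * P d x" "P d b = - P d x" "P d a = - \<i> * P d x"
    using rot[OF E(3,2,1,7) _ ccw(1,2)] rot[OF E(8) comm[OF E(1)] E(5,4) _ ccw(3,4)]
      rot[OF comm[OF E(4)] comm[OF E(2)] E(6,9) _ ccw(5,6)]
      rot[OF E(10) comm[OF E(6)] comm[OF E(5)] comm[OF E(3)] _ ccw(7,8)] by blast+
  have avoid: "pos L w \<notin> path_image (curve L v v')" if "{v, v'} \<in> E" "w \<in> V" "w \<noteq> v" "w \<noteq> v'" for v v' w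
    using draw[unfolded is_drawing_def, THEN conjunct2, THEN conjunct2, THEN conjunct1, rule_format, OF that(1), of w] that
    by simp
  have inj: "inj_on (pos L) V" using draw by (simp add: is_drawing_def)
  have ne: "pos L v \<noteq> pos L w" if "v \<in> V" "w \<in> V" "v \<noteq> w" for v w
    using inj_onD[OF inj] that by blast
  have "{a, b} \<inter> {c, d} = {}" "{a, d} \<inter> {b, c} = {}" using distinct by auto
  then have disjL: "path_image (curve L a b) \<inter> path_image (curve L c d) = {}"
    "path_image (curve L a d) \<inter> path_image (curve L b c) = {}"
    using same_embedding_disjoint[OF emb E(1,6)] same_embedding_disjoint[OF emb E(3,4)] disj
    unfolding edge_image_eq[OF draw E(1)] edge_image_eq[OF draw E(3)]
      edge_image_eq[OF draw E(4)] edge_image_eq[OF draw E(6)] by blast+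
  have neq: "a \<noteq> b" "a \<noteq> c" "a \<noteq> d" "b \<noteq> a" "b \<noteq> c" "b \<noteq> d" "c \<noteq> a" "c \<noteq> b" "c \<noteq> d" "d \<noteq> a" "d \<noteq> b" "d \<noteq> c"
    using distinct by auto
  \<comment> \<open>The port of each vertex towards its cyclic predecessor serves as reference. The
    vector \<open>u\<close> of the conclusion is \<open>\<i> * P a d\<close>, the port of
    \<open>a\<close> towards the opposite vertex \<open>c\<close>.\<close>
  have "P b a = - \<i> * P a d \<and>
    (\<exists>r>0. pos L b = pos L a + of_real r * (1 + \<i>) * (\<i> * P a d))"
  proof (rule K4_circle)
    show "joins (- P a d) (P b a) (pos L a) (pos L b) (path_image (curve L a b))"
      using P(4)[OF E(1)] ra by simp
    show "joins (\<i> * P a d) (\<i> * P c b) (pos L a) (pos L c) (path_image (curve L a c))"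
      using P(4)[OF E(2)] ra rc by simp
    show "joins (P a d) (- P d c) (pos L a) (pos L d) (path_image (curve L a d))"
      using P(4)[OF E(3)] rd by simp
    show "joins (- P b a) (P c b) (pos L b) (pos L c) (path_image (curve L b c))"
      using P(4)[OF E(4)] rb by simp
    show "joins (\<i> * P b a) (\<i> * P d c) (pos L b) (pos L d) (path_image (curve L b d))"
      using P(4)[OF E(5)] rb rd by (simp flip: mult.assoc)
    show "joins (- P c b) (P d c) (pos L c) (pos L d) (path_image (curve L c d))"
      using P(4)[OF E(6)] rc by simp
  qed (use E' P(2) V neq ne avoid disjL in simp_all)
  then obtain r where r: "0 < r" "pos L b = pos L a + of_real r * (1 + \<i>) * (\<i> * P a d)"
    and b: "P b a = - \<i> * P a d" by blast
  have "\<i> * P b b' = \<i> * - P a d" using b rb(1) by simp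
  then have "P b b' = - P a d" by (simp only: mult_left_cancel[OF complex_i_not_zero])
  then have "P b b' = \<i> * (\<i> * P a d)" by (simp flip: mult.assoc)
  moreover have "\<i> * P a d \<in> ports" using P(2)[OF E(3)] by (auto simp: ports_def)
  moreover have "P a a' = - (\<i> * P a d)" using ra by simp
  ultimately show ?thesis using r by blast
qed

section \<open>The graph\<close>

lemma graph_connected_path:
  assumes "successively (\<lambda>x y. {x, y} \<in> E) xs" shows "graph_connected (set xs) E"
proof -
  let ?R = "{(x, y). {x, y} \<in> E}"
  have "sym (?R\<^sup>*)" by (intro sym_rtrancl) (auto simp: sym_def insert_commute)
  have "(hd xs, v) \<in> ?R\<^sup>*" if "v \<in> set xs" for v
    using assms that
  proof (induction xs)
    case (Cons x xs)
    show ?case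
    proof (cases "v = x")
      case False
      then have v: "v \<in> set xs" using Cons.prems by simp
      then have "xs \<noteq> []" by auto
      then have "{x, hd xs} \<in> E" "successively (\<lambda>x y. {x, y} \<in> E) xs"
        using Cons.prems(1) by (auto simp: successively_Cons)
      then show ?thesis using Cons.IH v by (auto intro: converse_rtrancl_into_rtrancl)
    qed simp
  qed simp
  then show ?thesis
    unfolding graph_connected_def using \<open>sym (?R\<^sup>*)\<close> by (meson rtrancl_trans symD)
qed

text \<open>Removing a vertex from the cycle leaves a path: the part after it followed by the part
  before it.\<close>

lemma biconnected_Hamiltonian_cycle:
  assumes "distinct xs" "3 \<le> length xs" and cyc: "successively (\<lambda>x y. {x, y} \<in> E) (xs @ [hd xs])"
  shows "biconnected (set xs) E"
proof -
  have "graph_connected (set xs - {x}) {e \<in> E. x \<notin> e}" if "x \<in> set xs" for x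
  proof -
    obtain ys zs where xs: "xs = ys @ x # zs" using \<open>x \<in> set xs\<close> by (meson split_list)
    have "successively (\<lambda>x y. {x, y} \<in> E) (zs @ ys)"
    proof (cases "ys = []")
      case True
      then show ?thesis using cyc unfolding xs by (auto simp: successively_Cons successively_append_iff)
    next
      case False
      then show ?thesis using cyc unfolding xs
        by (auto simp: successively_Cons successively_append_iff)
    qed
    then have "successively (\<lambda>u v. {u, v} \<in> {e \<in> E. x \<notin> e}) (zs @ ys)"
      by (rule successively_mono) (use assms(1) in \<open>auto simp: xs\<close>)
    then have "graph_connected (set (zs @ ys)) {e \<in> E. x \<notin> e}" by (rule graph_connected_path)
    moreover have "set xs - {x} = set (zs @ ys)" using assms(1) by (auto simp: xs)
    ultimately show ?thesis by (simp only:)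
  qed
  moreover have "graph_connected (set xs) E"
    using cyc by (intro graph_connected_path) (simp add: successively_append_iff)
  moreover have "3 \<le> card (set xs)" using assms by (simp add: distinct_card)
  ultimately show ?thesis by (simp add: biconnected_def)
qed

definition edges_of :: "('a \<times> 'a) list \<Rightarrow> 'a set set" where
  "edges_of es = (\<lambda>(x, y). {x, y}) ` set es"

lemma in_edges_of: "{u, v} \<in> edges_of es \<longleftrightarrow> (u, v) \<in> set es \<or> (v, u) \<in> set es"
  by (auto simp: edges_of_def image_iff doubleton_eq_iff)

lemma vertex_degree_edges_of: "vertex_degree (edges_of es) v \<le> length (filter (\<lambda>(x, y). v = x \<or> v = y) es)"
proof -
  have "{e \<in> edges_of es. v \<in> e} = (\<lambda>(x, y). {x, y}) ` set (filter (\<lambda>(x, y). v = x \<or> v = y) es)"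
    by (auto simp: edges_of_def)
  then have "vertex_degree (edges_of es) v \<le> card (set (filter (\<lambda>(x, y). v = x \<or> v = y) es))"
    unfolding vertex_degree_def by (simp only:) (rule card_image_le, simp)
  also have "\<dots> \<le> length (filter (\<lambda>(x, y). v = x \<or> v = y) es)" by (rule card_length)
  finally show ?thesis .
qed

text \<open>In the notation of \<open>block_is_circle\<close>, the blocks are \<open>a, b, c, d = 0, 4, 3, 1\<close> and
  \<open>5, 9, 8, 6\<close>; the last two edges are the crossing links.\<close>

definition two_blocks :: "(nat \<times> nat) list" where
  "two_blocks =
    [(0, 1), (1, 3), (3, 4), (0, 4), (0, 3), (1, 4), (1, 2), (2, 3),
     (5, 6), (6, 8), (8, 9), (5, 9), (5, 8), (6, 9), (6, 7), (7, 8), (0, 5), (4, 9)]"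

lemma interleaved_two_blocks:
  "\<forall>(u, v)\<in>set two_blocks. \<forall>(x, y)\<in>set two_blocks. interleaved u v x y \<longrightarrow>
    ((u, v), (x, y)) \<in> {((0, 3), (1, 4)), ((1, 4), (0, 3)), ((5, 8), (6, 9)), ((6, 9), (5, 8)),
      ((0, 5), (4, 9)), ((4, 9), (0, 5))}"
  unfolding two_blocks_def interleaved_def by simp

lemma interleaved_cong:
  assumes "{u, v} = {u', v'}" "{x, y} = {x', y'}"
  shows "interleaved u v x y \<longleftrightarrow> interleaved u' v' x' y'"
  using assms by (auto simp: doubleton_eq_iff interleaved_def mult_ac)

section \<open>The two linked blocks as a counterexample\<close>

lemma outer_one_plane_two_blocks: "outer_one_plane_graph {..<10} (edges_of two_blocks) parabola_drawing"
proof (rule outer_one_plane_parabola)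
  show "simple_graph {..<10} (edges_of two_blocks)"
    by (simp add: simple_graph_def edges_of_def two_blocks_def)
next
  fix u v x y x' y'
  assume E: "{u, v} \<in> edges_of two_blocks" "{x, y} \<in> edges_of two_blocks" "{x', y'} \<in> edges_of two_blocks"
    and i: "interleaved u v x y" "interleaved u v x' y'"
  have ex: "\<exists>(x, y)\<in>set two_blocks. e = {x, y}" if "e \<in> edges_of two_blocks" for e
    using that by (auto simp: edges_of_def)
  obtain a b where ab: "(a, b) \<in> set two_blocks" "{u, v} = {a, b}" using ex[OF E(1)] by auto
  obtain c d where cd: "(c, d) \<in> set two_blocks" "{x, y} = {c, d}" using ex[OF E(2)] by auto
  obtain c' d' where cd': "(c', d') \<in> set two_blocks" "{x', y'} = {c', d'}" using ex[OF E(3)] by auto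
  have "interleaved a b c d" "interleaved a b c' d'"
    using i interleaved_cong[OF ab(2) cd(2)] interleaved_cong[OF ab(2) cd'(2)] by simp_all
  then have "(c, d) = (c', d')"
    using interleaved_two_blocks[THEN bspec, OF ab(1), unfolded prod.case, THEN bspec, OF cd(1)]
      interleaved_two_blocks[THEN bspec, OF ab(1), unfolded prod.case, THEN bspec, OF cd'(1)] by auto
  then show "{x, y} = {x', y'}" using cd(2) cd'(2) by simp
qed

lemma no_SC1_layout_two_blocks:
  assumes SC: "SC_layout 1 {..<10} (edges_of two_blocks) L"
    and emb: "same_embedding {..<10} (edges_of two_blocks) parabola_drawing L"
  shows False
proof -
  let ?E = "edges_of two_blocks"
  have draw: "is_drawing {..<10} ?E L" using SC by (simp add: SC_layout_def)
  obtain P where P: "\<And>u v. {u, v} \<in> ?E \<Longrightarrow> leaves (curve L u v) (P u v)"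
    "\<And>u v. {u, v} \<in> ?E \<Longrightarrow> P u v \<in> ports"
    "\<And>u v w. {u, v} \<in> ?E \<Longrightarrow> {u, w} \<in> ?E \<Longrightarrow> v \<noteq> w \<Longrightarrow> P u v \<noteq> P u w"
    "\<And>u v. {u, v} \<in> ?E \<Longrightarrow> joins (P u v) (P v u) (pos L u) (pos L v) (path_image (curve L u v))"
    using SC_layout_1_ports[OF SC] by metis
  have disj: "edge_image parabola_drawing {u, v} \<inter> edge_image parabola_drawing {x, y} = {}"
    if "\<not> interleaved u v x y" "{u, v} \<inter> {x, y} = {}" for u v x y
    using chords_cross(1)[OF _ _ that(2)] that(1) unfolding edge_image_parabola by blast
  obtain u r where u: "u \<in> ports" "0 < r" "P 0 5 = - u" "P 4 9 = \<i> * u"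
    "pos L 4 = pos L 0 + of_real r * (1 + \<i>) * u"
    using block_is_circle[OF draw emb P, of 0 4 3 1 5 9 2]
    by (simp add: in_edges_of two_blocks_def ccw_curves_parabola disj interleaved_def del: parabola_drawing_simps) blast
  obtain u' r' where u': "u' \<in> ports" "0 < r'" "P 5 0 = - u'" "P 9 4 = \<i> * u'"
    "pos L 9 = pos L 5 + of_real r' * (1 + \<i>) * u'"
    using block_is_circle[OF draw emb P, of 5 9 8 6 0 4 7]
    by (simp add: in_edges_of two_blocks_def ccw_curves_parabola disj interleaved_def del: parabola_drawing_simps) blast
  have link: "{0, 5} \<in> ?E" "{4, 9} \<in> ?E" by (simp_all add: in_edges_of two_blocks_def)
  \<comment> \<open>The intersection of the lines y = 5 x and y = 13 x - 36 that carry the two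
    links.\<close>
  have "Complex (9 / 2) (45 / 2) \<in> closed_segment (parabola 0) (parabola 5)"
    unfolding closed_segment_def
    by (intro CollectI exI[of _ "9 / 10"]) (simp add: parabola_def complex_eq_iff)
  moreover have "Complex (9 / 2) (45 / 2) \<in> closed_segment (parabola 4) (parabola 9)"
    unfolding closed_segment_def
    by (intro CollectI exI[of _ "1 / 10"]) (simp add: parabola_def complex_eq_iff)
  ultimately have "edge_image parabola_drawing {0, 5} \<inter> edge_image parabola_drawing {4, 9} \<noteq> {}"
    unfolding edge_image_parabola by blast
  then have cross: "path_image (curve L 0 5) \<inter> path_image (curve L 4 9) \<noteq> {}"
    using same_embedding_disjoint[OF emb link] unfolding edge_image_eq[OF draw link(1)] edge_image_eq[OF draw link(2)]
    by simp
  have "inj_on (pos L) {..<10}" using draw by (simp add: is_drawing_def)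
  then have ne: "pos L 0 \<noteq> pos L 9" "pos L 4 \<noteq> pos L 5" by (auto dest: inj_onD)
  show False
    using no_crossed_link[OF u(1) u'(1) u(2) u'(2) u(5) u'(5) _ _ ne cross]
      P(4)[OF link(1)] P(4)[OF link(2)] u(3,4) u'(3,4) by simp
qed

theorem theorem6:
  shows "\<exists>(V :: nat set) E D.
           outer_one_plane_graph V E D \<and> biconnected V E \<and> (\<forall>v\<in>V. vertex_degree E v \<le> 4) \<and>
           \<not> (\<exists>L. SC_layout 1 V E L \<and> same_embedding V E D L)"
proof (intro exI conjI ballI notI)
  show "outer_one_plane_graph {..<10} (edges_of two_blocks) parabola_drawing"
    by (rule outer_one_plane_two_blocks)
  \<comment> \<open>The cycle runs through the first block, over the link from 4 to 9, back through
    the second block and over the link from 5 to 0.\<close>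
  have "set [0, 1, 2, 3, 4, 9, 8, 7, 6, 5] = {..<10 :: nat}" by auto
  moreover have "biconnected (set [0, 1, 2, 3, 4, 9, 8, 7, 6, 5 :: nat]) (edges_of two_blocks)"
    by (rule biconnected_Hamiltonian_cycle) (simp_all add: in_edges_of two_blocks_def)
  ultimately show "biconnected {..<10} (edges_of two_blocks)" by simp
next
  fix v :: nat assume "v \<in> {..<10}"
  then have "v \<in> set [0, 1, 2, 3, 4, 5, 6, 7, 8, 9]" by auto
  then have "length (filter (\<lambda>(x, y). v = x \<or> v = y) two_blocks) \<le> 4" by (auto simp: two_blocks_def)
  then show "vertex_degree (edges_of two_blocks) v \<le> 4" by (rule le_trans[OF vertex_degree_edges_of])
next
  assume "\<exists>L. SC_layout 1 {..<10} (edges_of two_blocks) L \<and>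
    same_embedding {..<10} (edges_of two_blocks) parabola_drawing L"
  then show False using no_SC1_layout_two_blocks by blast
qed

end
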